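(* Let $P\subset\mathbb R^2$ be a compact triangle (the convex hull of three non-collinear points). a) Let $f$ be an irreducible element of $F_{\mathbb Z^2}$ and let $e=(e_1,e_2)=l_{P,f}^{-1}\cdot\operatorname{sm}(f)$. If $w:=|e|=e_1+e_2\ge\sqrt{2\operatorname{vol}(P)}$, then \[ S_P=\operatorname{hull}(\{(0,0),(v,0),(e_1,e_2),(0,v)\})\quad\text{with } v:=2\operatorname{vol}(P)/w . \] b) If there is no irreducible element $f$ of $F_{\mathbb Z^2}$ with $l_{P,f}^{-1}\cdot|\operatorname{sm}(f)|\ge\sqrt{2\operatorname{vol}(P)}$, then \[ S_P=\operatorname{hull}(\{(0,0),(v,0),(0,v)\})\quad\text{with } v:=\sqrt{2\operatorname{vol}(P)} . \]
   Context: $\mathbb N$ is the set of nonnegative integers; for $e\in\mathbb R_{\ge0}^2$, $|e|=e_1+e_2$; $\operatorname{hull}$ denotes convex hull; $\operatorname{vol}$ is area; $d\cdot A=\{da\mid a\in A\}$. Monomial order: monomials $X^e=X_1^{e_1}X_2^{e_2}$ ($e\in\mathbb N^2$) are ordered by the degree-lexicographic order with $X_1<X_2$, i.e. $X^e<X^{e'}$ iff $|e|<|e'|$, or $|e|=|e'|$ and $e_2<e_2'$. The leading monomial $\operatorname{lm}(p)$ of a nonzero $p\in\mathbb R[X_1,X_2]$ is its largest monomial. For finite $A\subseteq\mathbb R^2$, let $E_A$ be the set of $e\in\mathbb N^2$ such that $X^e$ is not the leading monomial of any nonzero polynomial in $\mathbb R[X_1,X_2]$ vanishing on $A$. For a bounded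 convex set $P\subseteq\mathbb R^2$ the sets $2^{-k}\cdot E_{2^k\cdot P\cap\mathbb Z^2}$ ($k\ge0$) form an ascending chain, and $S_P\subseteq\mathbb R_{\ge0}^2$ is the closure of $\bigcup_{k\ge0}2^{-k}\cdot E_{2^k\cdot P\cap\mathbb Z^2}$. $F_{\mathbb Z^2}$ is the ring of finitely supported functions $f:\mathbb Z^2\to\mathbb R$ with pointwise addition and convolution product $(f*g)(c)=\sum_{a+b=c}f(a)g(b)$ (isomorphic to the ring of Laurent polynomials $\mathbb R[X_1^{\pm1},X_2^{\pm1}]$); irreducibility is meant in this ring. For $0\ne f\in F_{\mathbb Z^2}$, $\operatorname{sm}(f)\in\mathbb N^2$ is the exponent such that $X^{\operatorname{sm}(f)}$ is the smallest monomial $X^e$ with $\sum_{a\in\mathbb Z^2}f(a)a^e\ne0$, where $a^e=a_1^{e_1}a_2^{e_2}$. For $0\neq f\in F_{\mathbb Z^2}$, $l_{P,f}$ is the smallest real number $l\ge0$ such that $\operatorname{supp}(f)\subseteq l\cdot P+v$ for some $v\in\mathbb R^2$ (it is positive when $f$ is irreducible). *)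

theory Defs
  imports "HOL-Analysis.Analysis" "HOL-Library.Poly_Mapping"
begin

text \<open>
  The multiplication of \<^typ>\<open>'a \<Rightarrow>\<^sub>0 'b\<close> is convolution.  Hence
  \<^typ>\<open>nat \<times> nat \<Rightarrow>\<^sub>0 real\<close> is the polynomial ring in two variables over the reals
  (a key is an exponent vector), and \<^typ>\<open>int \<times> int \<Rightarrow>\<^sub>0 real\<close> is the ring of
  finitely supported real functions on the integer lattice.
\<close>

type_synonym poly2 = "nat \<times> nat \<Rightarrow>\<^sub>0 real"
type_synonym lattice_fun = "int \<times> int \<Rightarrow>\<^sub>0 real"

definition nat_vec :: "nat \<times> nat \<Rightarrow> real \<times> real" where
  "nat_vec e = (real (fst e), real (snd e))"

definition int_vec :: "int \<times> int \<Rightarrow> real \<times> real" where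
  "int_vec a = (real_of_int (fst a), real_of_int (snd a))"

text \<open>The value at a point of the monomial with a given exponent (with 0 to the power 0 equal to 1).\<close>

definition monomial_at :: "nat \<times> nat \<Rightarrow> real \<times> real \<Rightarrow> real" where
  "monomial_at e x = fst x ^ fst e * snd x ^ snd e"

definition eval2 :: "poly2 \<Rightarrow> real \<times> real \<Rightarrow> real" where
  "eval2 p x = (\<Sum>e\<in>Poly_Mapping.keys p. Poly_Mapping.lookup p e * monomial_at e x)"

text \<open>Monomials are represented by their exponents; the first variable is the smaller one.\<close>

definition deglex_less :: "nat \<times> nat \<Rightarrow> nat \<times> nat \<Rightarrow> bool" where
  "deglex_less e e' \<longleftrightarrow>
     fst e + snd e < fst e' + snd e' \<or>
     fst e + snd e = fst e' + snd e' \<and> snd e < snd e'"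

text \<open>The exponent of the leading monomial; unspecified for the zero polynomial.\<close>

definition lm :: "poly2 \<Rightarrow> nat \<times> nat" where
  "lm p = (THE e. e \<in> Poly_Mapping.keys p \<and>
                  (\<forall>e'\<in>Poly_Mapping.keys p. e' \<noteq> e \<longrightarrow> deglex_less e' e))"

definition E_set :: "(real \<times> real) set \<Rightarrow> (nat \<times> nat) set" where
  "E_set A = {e. \<not> (\<exists>p. p \<noteq> 0 \<and> (\<forall>x\<in>A. eval2 p x = 0) \<and> lm p = e)}"

definition S_set :: "(real \<times> real) set \<Rightarrow> (real \<times> real) set" where
  "S_set P = closure (\<Union>k::nat.
     (\<lambda>e. (1 / 2 ^ k) *\<^sub>R nat_vec e) ` E_set ((\<lambda>x. 2 ^ k *\<^sub>R x) ` P \<inter> range int_vec))"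

definition moment :: "lattice_fun \<Rightarrow> nat \<times> nat \<Rightarrow> real" where
  "moment f e = (\<Sum>a\<in>Poly_Mapping.keys f. Poly_Mapping.lookup f a * monomial_at e (int_vec a))"

text \<open>The exponent of the smallest monomial with nonzero moment; unspecified for the zero function.\<close>

definition sm :: "lattice_fun \<Rightarrow> nat \<times> nat" where
  "sm f = (THE e. moment f e \<noteq> 0 \<and> (\<forall>e'. moment f e' \<noteq> 0 \<longrightarrow> e' \<noteq> e \<longrightarrow> deglex_less e e'))"

text \<open>
  The minimum is attained when \<^term>\<open>P\<close> is compact with nonempty interior and
  \<^term>\<open>f\<close> is nonzero.
\<close>

definition scale_size :: "(real \<times> real) set \<Rightarrow> lattice_fun \<Rightarrow> real" where
  "scale_size P f =
     (LEAST l. 0 \<le> l \<and> (\<exists>v. int_vec ` Poly_Mapping.keys f \<subseteq> (\<lambda>x. l *\<^sub>R x + v) ` P))"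

definition vol :: "(real \<times> real) set \<Rightarrow> real" where
  "vol P = measure lebesgue P"

end

theory Submission
  imports Defs "HOL-Computational_Algebra.Polynomial_Factorial" "HOL-Computational_Algebra.Field_as_Ring"
begin

text \<open>
  A polynomial exponent is standard for a finite set of lattice points iff it is the smallest exponent
  with nonzero moment of a function supported on that set, so the limit set consists of the
  rescaled exponents of all lattice functions that fit into dilates of the triangle.  For a
  triangle, both the smallest exponent and the size are additive under convolution.  If \<open>f\<close> is irreducible
  and does not divide \<open>h\<close>, then the orders of vanishing at 1 satisfy the Bezout-type bound
  \<open>|sm f| |sm h| \<le> 2 vol(P) size(f) size(h)\<close>, obtained from a dimension count with high powers of
  \<open>f\<close> and \<open>h\<close>.  Splitting off powers of \<open>f\<close> in case a), and factoring into irreducibles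
  in case b), this confines the limit set to the claimed polygon.  The area of this polygon
  is at most \<open>vol(P)\<close>, and counting standard monomials shows that nothing can be missing.
\<close>


text \<open>What makes triangles special: half-planes with the three normals of \<open>P\<close>, if
  they leave room, always cut out a homothetic copy of \<open>P\<close>. Hence the size of
  \<open>f\<close> is minus the sum of the minima of three linear functionals over the support, and
  each such minimum is additive under convolution. For other convex sets the size is in general only
  subadditive. The Bezout-type bound compares lattice point counts in copies of sizes
  \<open>n T\<close>, \<open>n (T - s)\<close>, \<open>n (T - t)\<close>,
  \<open>n (T - s - t)\<close>, where \<open>s\<close> and \<open>t\<close> are the sizes of
  \<open>f\<close> and \<open>h\<close>. The alternating sum of their areas is
  \<open>2 vol(P) s t\<close> times the square of \<open>n\<close>, whereas boundary errors grow
  only linearly; this is why high powers are taken. In case a), \<open>v w = 2 vol(P)\<close> turns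
  the bound into \<open>|sm h| \<le> v size(h)\<close>, so a product of \<open>f\<close>-powers and
  \<open>h\<close> contributes a multiple of \<open>e\<close> plus a vector of degree at most
  \<open>v size(h)\<close>. The condition on \<open>w\<close> says \<open>v \<le> w\<close>: the
  point \<open>e\<close> is on or beyond the segment from \<open>(v, 0)\<close> to
  \<open>(0, v)\<close>, and the diagonal to \<open>e\<close> cuts the hull into triangles of areas
  \<open>v e2 / 2\<close> and \<open>v e1 / 2\<close>, in total exactly \<open>vol(P)\<close>. In
  case b) the area is \<open>v v / 2 = vol(P)\<close> as well.\<close>

abbreviation supp :: "('a \<Rightarrow>\<^sub>0 'b::zero) \<Rightarrow> 'a set" where
  "supp \<equiv> Poly_Mapping.keys"

abbreviation cf :: "('a \<Rightarrow>\<^sub>0 'b::zero) \<Rightarrow> 'a \<Rightarrow> 'b" where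
  "cf \<equiv> Poly_Mapping.lookup"

abbreviation sgl :: "'a \<Rightarrow> 'b::zero \<Rightarrow> 'a \<Rightarrow>\<^sub>0 'b" where
  "sgl \<equiv> Poly_Mapping.single"

section \<open>Coefficients, linear functionals and convolution of finitely supported
  functions\<close>

lemma cf_sum_single:
  "finite A \<Longrightarrow> cf (\<Sum>a\<in>A. sgl a (u a)) b = (if b \<in> A then u b else (0::'b::comm_monoid_add))"
  by (simp add: lookup_sum lookup_single when_def)

lemma sum_single_cf: "(\<Sum>a\<in>supp f. sgl a (cf f a)) = (f :: 'a \<Rightarrow>\<^sub>0 'b::comm_monoid_add)"
  by (rule poly_mapping_eqI) (auto simp: cf_sum_single in_keys_iff)

text \<open>The linear functional with value \<open>\<phi> a\<close> on the unit mass at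
  \<open>a\<close>; with a monomial for \<open>\<phi>\<close> it is a moment.\<close>

definition pairing :: "('a \<Rightarrow> real) \<Rightarrow> ('a \<Rightarrow>\<^sub>0 real) \<Rightarrow> real" where
  "pairing \<phi> f = (\<Sum>a\<in>supp f. cf f a * \<phi> a)"

lemma pairing_superset:
  "finite A \<Longrightarrow> supp f \<subseteq> A \<Longrightarrow> pairing \<phi> f = (\<Sum>a\<in>A. cf f a * \<phi> a)"
  unfolding pairing_def by (rule sum.mono_neutral_left) (auto simp: in_keys_iff)

lemma pairing_add: "pairing \<phi> (f + g) = pairing \<phi> f + pairing \<phi> g"
proof -
  have "supp (f + g) \<subseteq> supp f \<union> supp g" by (rule keys_add)
  then show ?thesis
    by (simp add: pairing_superset[of "supp f \<union> supp g"] lookup_add algebra_simps sum.distrib)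
qed

lemma pairing_0 [simp]: "pairing \<phi> 0 = 0"
  by (simp add: pairing_def)

lemma pairing_single [simp]: "pairing \<phi> (sgl a x) = x * \<phi> a"
  by (simp add: pairing_def)

lemma pairing_sum: "pairing \<phi> (sum F A) = (\<Sum>i\<in>A. pairing \<phi> (F i))"
  by (induction A rule: infinite_finite_induct) (auto simp: pairing_add)

lemma mult_eq_sum_single:
  fixes f g :: "('a::monoid_add) \<Rightarrow>\<^sub>0 'b::semiring_0"
  shows "f * g = (\<Sum>a\<in>supp f. \<Sum>b\<in>supp g. sgl (a + b) (cf f a * cf g b))"
proof -
  have "f * g = (\<Sum>a\<in>supp f. sgl a (cf f a)) * (\<Sum>b\<in>supp g. sgl b (cf g b))"
    by (simp add: sum_single_cf)
  also have "\<dots> = (\<Sum>a\<in>supp f. \<Sum>b\<in>supp g. sgl (a + b) (cf f a * cf g b))"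
    by (simp add: sum_product mult_single)
  finally show ?thesis .
qed

lemma pairing_mult:
  fixes f g :: "('a::monoid_add) \<Rightarrow>\<^sub>0 real"
  shows "pairing \<phi> (f * g) = (\<Sum>a\<in>supp f. \<Sum>b\<in>supp g. cf f a * cf g b * \<phi> (a + b))"
  by (simp add: mult_eq_sum_single pairing_sum)

lemma cf_mult_keys:
  fixes f g :: "('a::ab_group_add) \<Rightarrow>\<^sub>0 real"
  shows "cf (f * g) c = (\<Sum>a\<in>supp f. cf f a * cf g (c - a))"
proof -
  have "cf (f * g) c = (\<Sum>a\<in>supp f. \<Sum>b\<in>supp g. if b = c - a then cf f a * cf g b else 0)"
    unfolding mult_eq_sum_single
    by (simp add: lookup_sum lookup_single when_def algebra_simps eq_diff_eq)
  also have "\<dots> = (\<Sum>a\<in>supp f. cf f a * cf g (c - a))"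
    by (rule sum.cong) (auto simp: in_keys_iff)
  finally show ?thesis .
qed

lemma cf_mult_superset:
  fixes f g :: "('a::ab_group_add) \<Rightarrow>\<^sub>0 real"
  assumes "finite A" "supp f \<subseteq> A"
  shows "cf (f * g) c = (\<Sum>a\<in>A. cf f a * cf g (c - a))"
  unfolding cf_mult_keys
  by (rule sum.mono_neutral_left) (use assms in \<open>auto simp: in_keys_iff\<close>)

text \<open>Only one pair can contribute to the convolution sum, so nothing cancels. Neither
  \<open>a0\<close> nor \<open>b0\<close> is assumed to lie in a support, hence the sum over
  \<open>insert a0 (supp f)\<close>.\<close>

lemma cf_mult_unique:
  fixes f g :: "('a::ab_group_add) \<Rightarrow>\<^sub>0 real"
  assumes "\<And>a b. a \<in> supp f \<Longrightarrow> b \<in> supp g \<Longrightarrow> a + b = a0 + b0 \<Longrightarrow> a = a0"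
  shows "cf (f * g) (a0 + b0) = cf f a0 * cf g b0"
proof -
  have "cf (f * g) (a0 + b0) = (\<Sum>a\<in>insert a0 (supp f). cf f a * cf g (a0 + b0 - a))"
    by (rule cf_mult_superset) auto
  also have "\<dots> = (\<Sum>a\<in>{a0}. cf f a * cf g (a0 + b0 - a))"
  proof (rule sum.mono_neutral_right)
    show "\<forall>a\<in>insert a0 (supp f) - {a0}. cf f a * cf g (a0 + b0 - a) = 0"
      using assms[of _ "a0 + b0 - _"] by (force simp: in_keys_iff)
  qed auto
  finally show ?thesis by simp
qed

subsection \<open>Extreme points of supports\<close>

text \<open>A linear functional may attain its minimum along a whole edge of the support. The
  lexicographic tie-break singles out one point there, and for additive \<open>\<phi>\<close> the
  refined order is still compatible with addition; \<open>lex_le_cancel\<close> extracts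
  this.\<close>

definition lex_le :: "(int \<times> int \<Rightarrow> real) \<Rightarrow> int \<times> int \<Rightarrow> int \<times> int \<Rightarrow> bool" where
  "lex_le \<phi> a b \<longleftrightarrow> \<phi> a < \<phi> b \<or> \<phi> a = \<phi> b \<and> (fst a < fst b \<or> fst a = fst b \<and> snd a \<le> snd b)"

lemma lex_le_imp_le: "lex_le \<phi> a b \<Longrightarrow> \<phi> a \<le> \<phi> b"
  by (auto simp: lex_le_def)

lemma lex_le_least:
  assumes "finite A" "A \<noteq> {}"
  shows "\<exists>a\<in>A. \<forall>b\<in>A. lex_le \<phi> a b"
  using assms
proof (induction A rule: finite_ne_induct)
  case (singleton x)
  then show ?case by (simp add: lex_le_def)
next
  case (insert x F)
  then obtain a where a: "a \<in> F" "\<forall>b\<in>F. lex_le \<phi> a b" by blast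
  show ?case
  proof (cases "lex_le \<phi> a x")
    case True
    then show ?thesis using a by blast
  next
    case False
    then have "\<forall>b\<in>insert x F. lex_le \<phi> x b"
      using a unfolding lex_le_def by (smt (verit) insert_iff)
    then show ?thesis by blast
  qed
qed

definition lattice_additive :: "(int \<times> int \<Rightarrow> real) \<Rightarrow> bool" where
  "lattice_additive \<phi> \<longleftrightarrow> (\<forall>a b. \<phi> (a + b) = \<phi> a + \<phi> b)"

lemma lattice_additiveD: "lattice_additive \<phi> \<Longrightarrow> \<phi> (a + b) = \<phi> a + \<phi> b"
  unfolding lattice_additive_def by blast

lemma lex_le_cancel:
  assumes "lattice_additive \<phi>" "lex_le \<phi> a0 a" "lex_le \<phi> b0 b" "a + b = a0 + b0"
  shows "a = a0"
proof -
  have "\<phi> a + \<phi> b = \<phi> a0 + \<phi> b0" using assms by (metis lattice_additive_def)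
  moreover have "fst a + fst b = fst a0 + fst b0" "snd a + snd b = snd a0 + snd b0"
    using assms(4) by (metis fst_add, metis snd_add)
  ultimately have "fst a = fst a0 \<and> snd a = snd a0"
    using assms(2,3) unfolding lex_le_def by linarith
  then show ?thesis by (simp add: prod_eq_iff)
qed

definition low :: "(int \<times> int \<Rightarrow> real) \<Rightarrow> lattice_fun \<Rightarrow> int \<times> int" where
  "low \<phi> f = (SOME a. a \<in> supp f \<and> (\<forall>b\<in>supp f. lex_le \<phi> a b))"

lemma low:
  assumes "f \<noteq> 0"
  shows "low \<phi> f \<in> supp f" "\<And>b. b \<in> supp f \<Longrightarrow> lex_le \<phi> (low \<phi> f) b"
proof -
  have "\<exists>a. a \<in> supp f \<and> (\<forall>b\<in>supp f. lex_le \<phi> a b)"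
    using lex_le_least[of "supp f" \<phi>] assms by auto
  from someI_ex[OF this] show "low \<phi> f \<in> supp f" "\<And>b. b \<in> supp f \<Longrightarrow> lex_le \<phi> (low \<phi> f) b"
    unfolding low_def by blast+
qed

text \<open>The sum of the two least points is reached by no other pair, so the corner coefficients
  multiply. This excludes zero divisors and makes minima of additive functionals add up.\<close>

lemma cf_mult_low:
  assumes "lattice_additive \<phi>" "f \<noteq> 0" "g \<noteq> 0"
  shows "cf (f * g) (low \<phi> f + low \<phi> g) = cf f (low \<phi> f) * cf g (low \<phi> g)"
  by (rule cf_mult_unique) (use assms low lex_le_cancel in metis)

lemma lattice_fun_mult_eq_0_iff [simp]: "(f :: lattice_fun) * g = 0 \<longleftrightarrow> f = 0 \<or> g = 0"
proof (cases "f = 0 \<or> g = 0")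
  case False
  \<comment> \<open>The zero functional leaves the plain lexicographic order.\<close>
  have "lattice_additive (\<lambda>_. 0)" by (simp add: lattice_additive_def)
  from cf_mult_low[OF this, of f g] False low(1)[of f "\<lambda>_. 0"] low(1)[of g "\<lambda>_. 0"]
  have "cf (f * g) (low (\<lambda>_. 0) f + low (\<lambda>_. 0) g) \<noteq> 0"
    by (simp add: in_keys_iff)
  then show ?thesis using False by auto
qed auto

lemma lattice_fun_power_eq_0_iff [simp]: "(f :: lattice_fun) ^ n = 0 \<longleftrightarrow> f = 0 \<and> n > 0"
  by (induction n) auto

lemma lattice_fun_mult_cancel: "(f :: lattice_fun) \<noteq> 0 \<Longrightarrow> f * g = f * h \<longleftrightarrow> g = h"
  using lattice_fun_mult_eq_0_iff[of f "g - h"] by (auto simp: algebra_simps)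

definition mn :: "(int \<times> int \<Rightarrow> real) \<Rightarrow> lattice_fun \<Rightarrow> real" where
  "mn \<phi> f = Min (\<phi> ` supp f)"

lemma mn_le: "a \<in> supp f \<Longrightarrow> mn \<phi> f \<le> \<phi> a"
  unfolding mn_def by auto

lemma mn_eq_low: "f \<noteq> 0 \<Longrightarrow> mn \<phi> f = \<phi> (low \<phi> f)"
  unfolding mn_def by (rule Min_eqI) (auto simp: low(1) intro: lex_le_imp_le low(2))

lemma mn_ge_iff: "f \<noteq> 0 \<Longrightarrow> c \<le> mn \<phi> f \<longleftrightarrow> (\<forall>a\<in>supp f. c \<le> \<phi> a)"
  unfolding mn_def by (subst Min_ge_iff) auto

lemma mn_mult:
  assumes "lattice_additive \<phi>" "f \<noteq> 0" "g \<noteq> 0"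
  shows "mn \<phi> (f * g) = mn \<phi> f + mn \<phi> g"
proof (rule antisym)
  have "low \<phi> f + low \<phi> g \<in> supp (f * g)"
    using cf_mult_low[OF assms] low(1)[OF assms(2), of \<phi>] low(1)[OF assms(3), of \<phi>]
    by (simp add: in_keys_iff)
  from mn_le[OF this, of \<phi>] show "mn \<phi> (f * g) \<le> mn \<phi> f + mn \<phi> g"
    using assms by (simp add: mn_eq_low lattice_additiveD)
  show "mn \<phi> f + mn \<phi> g \<le> mn \<phi> (f * g)"
  proof (subst mn_ge_iff)
    show "\<forall>c\<in>supp (f * g). mn \<phi> f + mn \<phi> g \<le> \<phi> c"
    proof
      fix c assume "c \<in> supp (f * g)"
      then obtain a b where "a \<in> supp f" "b \<in> supp g" "c = a + b"
        using keys_mult[of f g] by auto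
      then show "mn \<phi> f + mn \<phi> g \<le> \<phi> c"
        using assms mn_le[of a f \<phi>] mn_le[of b g \<phi>] by (simp add: lattice_additiveD)
    qed
  qed (use assms in simp)
qed

lemma mn_power:
  assumes "lattice_additive \<phi>" "f \<noteq> 0"
  shows "mn \<phi> (f ^ n) = real n * mn \<phi> f"
proof (induction n)
  case 0
  have "\<phi> 0 = 0" using assms by (metis add_cancel_right_right lattice_additive_def)
  then show ?case by (simp add: mn_def)
next
  case (Suc n)
  then show ?case using assms by (simp add: mn_mult algebra_simps)
qed

subsection \<open>Moments\<close>

lemma moment_pairing: "moment f e = pairing (\<lambda>a. monomial_at e (int_vec a)) f"
  by (simp add: moment_def pairing_def)

lemma monomial_at_add:
  "monomial_at (i, j) (int_vec (a + b)) =
    (\<Sum>i'\<le>i. \<Sum>j'\<le>j. real (i choose i') * real (j choose j') *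
       (monomial_at (i', j') (int_vec a) * monomial_at (i - i', j - j') (int_vec b)))"
  unfolding monomial_at_def int_vec_def by (simp add: binomial_ring sum_product mult_ac)

text \<open>Leibniz rule: a moment is an iterated Euler derivative of the Laurent polynomial,
  evaluated at \<open>(1, 1)\<close>.\<close>

lemma moment_mult:
  "moment (f * g) (i, j) = (\<Sum>i'\<le>i. \<Sum>j'\<le>j. real (i choose i') * real (j choose j') *
       (moment f (i', j') * moment g (i - i', j - j')))"
proof -
  have "moment (f * g) (i, j) = (\<Sum>a\<in>supp f. \<Sum>b\<in>supp g. \<Sum>i'\<le>i. \<Sum>j'\<le>j.
      real (i choose i') * real (j choose j') * ((cf f a * monomial_at (i', j') (int_vec a)) *
        (cf g b * monomial_at (i - i', j - j') (int_vec b))))"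
    unfolding moment_pairing pairing_mult monomial_at_add
    by (simp add: sum_distrib_left sum_distrib_right algebra_simps)
  also have "\<dots> = (\<Sum>a\<in>supp f. \<Sum>i'\<le>i. \<Sum>j'\<le>j. \<Sum>b\<in>supp g.
      real (i choose i') * real (j choose j') * ((cf f a * monomial_at (i', j') (int_vec a)) *
        (cf g b * monomial_at (i - i', j - j') (int_vec b))))"
    by (intro sum.cong refl, subst sum.swap, intro sum.cong refl, rule sum.swap)
  also have "\<dots> = (\<Sum>i'\<le>i. \<Sum>j'\<le>j. \<Sum>a\<in>supp f. \<Sum>b\<in>supp g.
      real (i choose i') * real (j choose j') * ((cf f a * monomial_at (i', j') (int_vec a)) *
        (cf g b * monomial_at (i - i', j - j') (int_vec b))))"
    by (subst sum.swap, intro sum.cong refl, rule sum.swap)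
  also have "\<dots> = (\<Sum>i'\<le>i. \<Sum>j'\<le>j. real (i choose i') * real (j choose j') *
       (moment f (i', j') * moment g (i - i', j - j')))"
    unfolding moment_def unfolding sum_product unfolding sum_distrib_left by (rule refl)
  finally show ?thesis .
qed

lemma moment_poly:
  "(\<Sum>a\<in>supp f. cf f a * (poly p (real_of_int (fst a)) * poly q (real_of_int (snd a)))) =
    (\<Sum>i\<le>degree p. \<Sum>j\<le>degree q. coeff p i * coeff q j * moment f (i, j))"
proof -
  have "(\<Sum>a\<in>supp f. cf f a * (poly p (real_of_int (fst a)) * poly q (real_of_int (snd a)))) =
     (\<Sum>a\<in>supp f. \<Sum>i\<le>degree p. \<Sum>j\<le>degree q. coeff p i * coeff q j *
       (cf f a * monomial_at (i, j) (int_vec a)))"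
    unfolding poly_altdef unfolding sum_product unfolding sum_distrib_left
    by (intro sum.cong refl) (simp add: monomial_at_def int_vec_def)
  also have "\<dots> = (\<Sum>i\<le>degree p. \<Sum>j\<le>degree q. \<Sum>a\<in>supp f. coeff p i * coeff q j *
       (cf f a * monomial_at (i, j) (int_vec a)))"
    by (subst sum.swap, intro sum.cong refl, rule sum.swap)
  finally show ?thesis by (simp add: moment_def sum_distrib_left)
qed

lemma moment_neq_0_ex:
  assumes "f \<noteq> 0"
  shows "\<exists>e. moment f e \<noteq> 0"
proof (rule ccontr)
  assume *: "\<nexists>e. moment f e \<noteq> 0"
  from assms obtain c where c: "c \<in> supp f" by (metis keys_eq_empty all_not_in_conv)
  \<comment> \<open>The product of \<open>p\<close> in the first and \<open>q\<close> in the second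
    coordinate vanishes on the support except at \<open>c\<close>, so the corresponding combination
    of moments isolates the coefficient there.\<close>
  define p q :: "real poly" where
    "p = (\<Prod>x\<in>fst ` supp f - {fst c}. [:- real_of_int x, 1:])" and
    "q = (\<Prod>x\<in>snd ` supp f - {snd c}. [:- real_of_int x, 1:])"
  have p: "poly p (real_of_int x) = 0 \<longleftrightarrow> x \<in> fst ` supp f - {fst c}" for x
    unfolding p_def poly_prod by (subst prod_zero_iff) auto
  have q: "poly q (real_of_int x) = 0 \<longleftrightarrow> x \<in> snd ` supp f - {snd c}" for x
    unfolding q_def poly_prod by (subst prod_zero_iff) auto
  have "(\<Sum>a\<in>supp f. cf f a * (poly p (real_of_int (fst a)) * poly q (real_of_int (snd a)))) = 0"
    unfolding moment_poly using * by simp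
  also have "(\<Sum>a\<in>supp f. cf f a * (poly p (real_of_int (fst a)) * poly q (real_of_int (snd a)))) =
     (\<Sum>a\<in>{c}. cf f a * (poly p (real_of_int (fst a)) * poly q (real_of_int (snd a))))"
    by (rule sum.mono_neutral_right) (use c p q in \<open>force simp: prod_eq_iff\<close>)+
  finally show False using c p[of "fst c"] q[of "snd c"] by (simp add: in_keys_iff)
qed

section \<open>The degree-lexicographic order and smallest exponents\<close>

lemma deglex_less_wf: "wfp deglex_less"
proof -
  have "{(a, b). deglex_less a b} = inv_image (less_than <*lex*> less_than) (\<lambda>e. (fst e + snd e, snd e))"
    by (auto simp: deglex_less_def)
  then show ?thesis by (simp add: wfp_def wf_lex_prod)
qed

lemma deglex_less_linear: "deglex_less a b \<or> a = b \<or> deglex_less b a"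
  by (auto simp: deglex_less_def prod_eq_iff)

lemma deglex_less_asym: "deglex_less a b \<Longrightarrow> \<not> deglex_less b a"
  by (auto simp: deglex_less_def)

lemma deglex_less_trans: "deglex_less a b \<Longrightarrow> deglex_less b c \<Longrightarrow> deglex_less a c"
  by (auto simp: deglex_less_def)

lemma deglex_less_irrefl [simp]: "\<not> deglex_less a a"
  by (auto simp: deglex_less_def)

lemma finite_deglex_less: "finite {e'. deglex_less e' e}"
proof (rule finite_subset)
  show "{e'. deglex_less e' e} \<subseteq> {..fst e + snd e} \<times> {..fst e + snd e}"
    by (auto simp: deglex_less_def)
qed auto

lemma sm_eqI:
  assumes "moment f e \<noteq> 0" "\<And>e'. deglex_less e' e \<Longrightarrow> moment f e' = 0"
  shows "sm f = e"
  unfolding sm_def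
  by (rule the_equality) (use assms deglex_less_linear deglex_less_asym in metis)+

lemma sm_ex:
  assumes "f \<noteq> 0"
  obtains e where "moment f e \<noteq> 0" "\<And>e'. deglex_less e' e \<Longrightarrow> moment f e' = 0"
proof -
  have "{e. moment f e \<noteq> 0} \<noteq> {}" using moment_neq_0_ex[OF assms] by simp
  from deglex_less_wf[unfolded wfp_iff_ex_minimal, rule_format, OF this]
  obtain e where "e \<in> {e. moment f e \<noteq> 0}" "\<forall>y. deglex_less y e \<longrightarrow> y \<notin> {e. moment f e \<noteq> 0}"
    by blast
  then show thesis using that[of e] by blast
qed

lemma moment_sm: "f \<noteq> 0 \<Longrightarrow> moment f (sm f) \<noteq> 0"
  by (metis sm_ex sm_eqI)

lemma moment_below_sm: "f \<noteq> 0 \<Longrightarrow> deglex_less e (sm f) \<Longrightarrow> moment f e = 0"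
  by (metis sm_ex sm_eqI)

text \<open>The order is compatible with addition: in the Leibniz sum every term except the product
  of the two smallest moments has a factor below \<open>sm f\<close> or \<open>sm g\<close>, and the
  binomial coefficients of that term are nonzero.\<close>

lemma sm_mult:
  assumes "f \<noteq> 0" "g \<noteq> 0"
  shows "sm (f * g) = sm f + sm g"
proof (rule sm_eqI)
  obtain i1 j1 where e1: "sm f = (i1, j1)" by (cases "sm f")
  obtain i2 j2 where e2: "sm g = (i2, j2)" by (cases "sm g")
  let ?t = "\<lambda>i j i' j'. real (i choose i') * real (j choose j') *
       (moment f (i', j') * moment g (i - i', j - j'))"
  have "moment (f * g) (i1 + i2, j1 + j2) =
     (\<Sum>x\<in>{..i1+i2}\<times>{..j1+j2}. ?t (i1+i2) (j1+j2) (fst x) (snd x))"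
    unfolding moment_mult by (simp add: sum.cartesian_product case_prod_beta)
  also have "\<dots> = (\<Sum>x\<in>{(i1,j1)}. ?t (i1+i2) (j1+j2) (fst x) (snd x))"
  proof (rule sum.mono_neutral_right)
    show "\<forall>x\<in>{..i1+i2}\<times>{..j1+j2} - {(i1,j1)}. ?t (i1+i2) (j1+j2) (fst x) (snd x) = 0"
    proof
      fix x assume x: "x \<in> {..i1+i2}\<times>{..j1+j2} - {(i1,j1)}"
      then have "deglex_less x (sm f) \<or> deglex_less (i1 + i2 - fst x, j1 + j2 - snd x) (sm g)"
        unfolding e1 e2 deglex_less_def by (cases x) auto
      then show "?t (i1+i2) (j1+j2) (fst x) (snd x) = 0"
        using moment_below_sm[OF assms(1), of x]
          moment_below_sm[OF assms(2), of "(i1 + i2 - fst x, j1 + j2 - snd x)"] by auto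
    qed
  qed auto
  also have "\<dots> \<noteq> 0" using moment_sm[OF assms(1)] moment_sm[OF assms(2)] by (simp add: e1 e2)
  finally show "moment (f * g) (sm f + sm g) \<noteq> 0" by (simp add: e1 e2)
  fix e assume less: "deglex_less e (sm f + sm g)"
  obtain i j where e: "e = (i, j)" by (cases e)
  have "?t i j i' j' = 0" if "i' \<le> i" "j' \<le> j" for i' j'
  proof -
    have "deglex_less (i', j') (sm f) \<or> deglex_less (i - i', j - j') (sm g)"
      using less that unfolding e e1 e2 deglex_less_def by auto
    then show ?thesis
      using moment_below_sm[OF assms(1), of "(i', j')"]
        moment_below_sm[OF assms(2), of "(i - i', j - j')"] by auto
  qed
  then show "moment (f * g) e = 0" unfolding e moment_mult by (simp add: sum.neutral)
qed

lemma sm_1: "sm 1 = 0"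
  by (rule sm_eqI) (auto simp: moment_def monomial_at_def deglex_less_def)

lemma sm_power: "f \<noteq> 0 \<Longrightarrow> sm (f ^ n) = (n * fst (sm f), n * snd (sm f))"
  by (induction n) (auto simp: sm_1 sm_mult prod_eq_iff zero_prod_def)

text \<open>For nonzero \<open>f\<close> this is the order of vanishing at \<open>(1, 1)\<close> of
  the Laurent polynomial, since moments are Euler derivatives there.\<close>

abbreviation (input) mult_at_one :: "lattice_fun \<Rightarrow> nat" where
  "mult_at_one f \<equiv> fst (sm f) + snd (sm f)"

lemma moment_below_mult: "f \<noteq> 0 \<Longrightarrow> fst e + snd e < mult_at_one f \<Longrightarrow> moment f e = 0"
  by (rule moment_below_sm) (auto simp: deglex_less_def)

subsection \<open>Linear systems\<close>

lemma underdetermined_system: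
  fixes c :: "'j \<Rightarrow> 'i \<Rightarrow> real"
  assumes "finite J" "finite I" "card J < card I"
  shows "\<exists>u. (\<exists>i\<in>I. u i \<noteq> 0) \<and> (\<forall>j\<in>J. (\<Sum>i\<in>I. c j i * u i) = 0)"
  using assms
proof (induction J arbitrary: I c rule: finite_induct)
  case empty
  then show ?case by (auto intro!: exI[of _ "\<lambda>_. 1"] simp: card_gt_0_iff)
next
  case (insert j J)
  show ?case
  proof (cases "\<forall>i\<in>I. c j i = 0")
    case True
    have "card J < card I" using insert by simp
    from insert.IH[OF insert.prems(1) this, of c] obtain u
      where "\<exists>i\<in>I. u i \<noteq> 0" "\<forall>j\<in>J. (\<Sum>i\<in>I. c j i * u i) = 0" by blast
    then show ?thesis using True by (intro exI[of _ u]) simp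
  next
    case False
    then obtain i0 where i0: "i0 \<in> I" "c j i0 \<noteq> 0" by blast
    define I' where "I' = I - {i0}"
    have I': "finite I'" "i0 \<notin> I'" "I = insert i0 I'" using insert.prems i0 by (auto simp: I'_def)
    have "card J < card I'" using insert I' by simp
    \<comment> \<open>Gaussian elimination: equation \<open>j\<close> expresses the unknown
      \<open>i0\<close> by the others, and substituting this into the remaining equations leaves a
      system on \<open>I'\<close>.\<close>
    from insert.IH[OF I'(1) this, of "\<lambda>j' i. c j' i - c j' i0 * c j i / c j i0"]
    obtain u where u: "\<exists>i\<in>I'. u i \<noteq> 0"
      "\<forall>j'\<in>J. (\<Sum>i\<in>I'. (c j' i - c j' i0 * c j i / c j i0) * u i) = 0" by blast
    define s where "s = (\<Sum>i\<in>I'. c j i * u i)"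
    define u' where "u' = u(i0 := - s / c j i0)"
    have sum: "(\<Sum>i\<in>I. c j' i * u' i) = c j' i0 * (- s / c j i0) + (\<Sum>i\<in>I'. c j' i * u i)" for j'
    proof -
      have "(\<Sum>i\<in>I'. c j' i * u' i) = (\<Sum>i\<in>I'. c j' i * u i)"
        by (rule sum.cong) (use I' in \<open>auto simp: u'_def\<close>)
      then show ?thesis using I' by (simp add: u'_def)
    qed
    have "(\<Sum>i\<in>I. c j' i * u' i) = 0" if "j' \<in> insert j J" for j'
    proof (cases "j' = j")
      case True
      then show ?thesis using i0 unfolding sum by (simp add: s_def)
    next
      case False
      with that u have "(\<Sum>i\<in>I'. (c j' i - c j' i0 * c j i / c j i0) * u i) = 0" by blast
      also have "(\<Sum>i\<in>I'. (c j' i - c j' i0 * c j i / c j i0) * u i) =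
          (\<Sum>i\<in>I'. c j' i * u i) - (c j' i0 / c j i0) * s"
        unfolding s_def sum_distrib_left sum_subtractf[symmetric]
        by (rule sum.cong) (simp_all add: algebra_simps)
      finally show ?thesis unfolding sum by simp
    qed
    moreover have "\<exists>i\<in>I. u' i \<noteq> 0" using u(1) I' by (auto simp: u'_def)
    ultimately show ?thesis by blast
  qed
qed

text \<open>This duality turns the absence of a function with prescribed moments into a polynomial
  relation on the points, see \<open>E_set_imp_sm\<close>. In the induction a multiple of the new
  functional is subtracted so that \<open>d\<close> vanishes on the kernel of the old ones.\<close>

lemma functional_in_span:
  fixes c :: "'j \<Rightarrow> 'i \<Rightarrow> real"
  assumes "finite J" "finite I"
    and "\<And>u. \<forall>j\<in>J. (\<Sum>i\<in>I. c j i * u i) = 0 \<Longrightarrow> (\<Sum>i\<in>I. d i * u i) = 0"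
  shows "\<exists>l. \<forall>i\<in>I. d i = (\<Sum>j\<in>J. l j * c j i)"
  using assms
proof (induction J arbitrary: d rule: finite_induct)
  case empty
  have "d i = 0" if "i \<in> I" for i
    using empty(2)[of "\<lambda>k. if k = i then 1 else 0"] empty(1) that by (simp add: if_distrib cong: if_cong)
  then show ?case by auto
next
  case (insert j J)
  show ?case
  proof (cases "\<forall>u. (\<forall>j\<in>J. (\<Sum>i\<in>I. c j i * u i) = 0) \<longrightarrow> (\<Sum>i\<in>I. d i * u i) = 0")
    case True
    with insert.IH[OF insert.prems(1), of d] obtain l where l: "\<forall>i\<in>I. d i = (\<Sum>j\<in>J. l j * c j i)" by blast
    have "d i = (\<Sum>k\<in>insert j J. (l(j := 0)) k * c k i)" if "i \<in> I" for i
    proof -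
      have "(\<Sum>k\<in>J. (l(j := 0)) k * c k i) = (\<Sum>k\<in>J. l k * c k i)"
        by (rule sum.cong) (use insert.hyps in auto)
      then show ?thesis using insert.hyps l that by simp
    qed
    then show ?thesis by blast
  next
    case False
    then obtain u0 where u0: "\<forall>j\<in>J. (\<Sum>i\<in>I. c j i * u0 i) = 0" "(\<Sum>i\<in>I. d i * u0 i) \<noteq> 0" by blast
    define D where "D = (\<Sum>i\<in>I. d i * u0 i)"
    define C where "C = (\<Sum>i\<in>I. c j i * u0 i)"
    have "C \<noteq> 0" using insert.prems(2)[of u0] u0 by (auto simp: C_def)
    \<comment> \<open>The factor \<open>D / C\<close> is forced by evaluation at \<open>u0\<close>.
      It suffices, because every \<open>u\<close> in the kernel of the old functionals becomes a
      common zero of all of them after subtracting a multiple of \<open>u0\<close>.\<close>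
    have "\<exists>l. \<forall>i\<in>I. d i - D / C * c j i = (\<Sum>k\<in>J. l k * c k i)"
    proof (rule insert.IH[OF insert.prems(1)])
      fix u assume u: "\<forall>j\<in>J. (\<Sum>i\<in>I. c j i * u i) = 0"
      define s where "s = (\<Sum>i\<in>I. c j i * u i) / C"
      have lin: "(\<Sum>i\<in>I. b i * (u i - s * u0 i)) = (\<Sum>i\<in>I. b i * u i) - s * (\<Sum>i\<in>I. b i * u0 i)" for b
        by (simp add: right_diff_distrib sum_subtractf sum_distrib_left mult_ac)
      have "\<forall>k\<in>insert j J. (\<Sum>i\<in>I. c k i * (u i - s * u0 i)) = 0"
        unfolding lin using u u0(1) \<open>C \<noteq> 0\<close> by (simp add: s_def flip: C_def)
      from insert.prems(2)[OF this] have "(\<Sum>i\<in>I. d i * u i) = s * D"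
        unfolding lin by (simp add: D_def)
      then show "(\<Sum>i\<in>I. (d i - D / C * c j i) * u i) = 0"
        unfolding left_diff_distrib sum_subtractf mult.assoc sum_distrib_left[symmetric]
        by (simp add: s_def)
    qed
    then obtain l where l: "\<forall>i\<in>I. d i - D / C * c j i = (\<Sum>k\<in>J. l k * c k i)" by blast
    have "d i = (\<Sum>k\<in>insert j J. (l(j := D / C)) k * c k i)" if "i \<in> I" for i
    proof -
      have "(\<Sum>k\<in>J. (l(j := D / C)) k * c k i) = (\<Sum>k\<in>J. l k * c k i)"
        by (rule sum.cong) (use insert.hyps in auto)
      then show ?thesis using insert.hyps l that by (simp add: algebra_simps)
    qed
    then show ?thesis by blast
  qed
qed

subsection \<open>Standard monomials as smallest monomials of lattice functions\<close>

lemma lm_eqI: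
  assumes "e \<in> supp p" "\<And>e'. e' \<in> supp p \<Longrightarrow> e' \<noteq> e \<Longrightarrow> deglex_less e' e"
  shows "lm p = e"
  unfolding lm_def
proof (rule the_equality)
  fix e' assume e': "e' \<in> supp p \<and> (\<forall>e''\<in>supp p. e'' \<noteq> e' \<longrightarrow> deglex_less e'' e')"
  show "e' = e"
    using e' assms(1) assms(2)[of e'] deglex_less_asym[of e e'] by (cases "e' = e") auto
qed (use assms in blast)

lemma deglex_max:
  assumes "finite A" "A \<noteq> {}"
  shows "\<exists>a\<in>A. \<forall>b\<in>A. b \<noteq> a \<longrightarrow> deglex_less b a"
  using assms
proof (induction A rule: finite_ne_induct)
  case (insert x F)
  then obtain a where "a \<in> F" "\<forall>b\<in>F. b \<noteq> a \<longrightarrow> deglex_less b a" by blast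
  then show ?case
    using deglex_less_linear[of x a] deglex_less_trans[of _ a x] by (metis insert_iff)
qed simp

lemma lm_props:
  assumes "p \<noteq> 0"
  shows "lm p \<in> supp p" "\<And>e. e \<in> supp p \<Longrightarrow> e \<noteq> lm p \<Longrightarrow> deglex_less e (lm p)"
proof -
  have "supp p \<noteq> {}" using assms by simp
  with deglex_max[of "supp p"] obtain a
    where a: "a \<in> supp p" "\<forall>b\<in>supp p. b \<noteq> a \<longrightarrow> deglex_less b a" by auto
  then have "lm p = a" by (intro lm_eqI) auto
  then show "lm p \<in> supp p" "\<And>e. e \<in> supp p \<Longrightarrow> e \<noteq> lm p \<Longrightarrow> deglex_less e (lm p)"
    using a by auto
qed

lemma sum_eval2:
  "(\<Sum>a\<in>supp f. cf f a * eval2 p (int_vec a)) = (\<Sum>e\<in>supp p. cf p e * moment f e)"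
proof -
  have "(\<Sum>a\<in>supp f. cf f a * eval2 p (int_vec a)) =
    (\<Sum>a\<in>supp f. \<Sum>e\<in>supp p. cf p e * (cf f a * monomial_at e (int_vec a)))"
    by (simp add: eval2_def sum_distrib_left mult_ac)
  also have "\<dots> = (\<Sum>e\<in>supp p. cf p e * moment f e)"
    by (subst sum.swap) (simp add: moment_def sum_distrib_left)
  finally show ?thesis .
qed

lemma moment_sum_single: "moment (\<Sum>a\<in>A. sgl a (u a)) e = (\<Sum>a\<in>A. u a * monomial_at e (int_vec a))"
  by (simp add: moment_pairing pairing_sum)

text \<open>Pairing \<open>f\<close> with a polynomial gives the sum of coefficient times moment
  over its monomials. If the leading exponent were \<open>sm f\<close>, only that term would
  survive, as the other monomials lie below; but the pairing is zero for a polynomial vanishing on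
  the support.\<close>

lemma sm_in_E_set:
  assumes "f \<noteq> 0" "supp f \<subseteq> A"
  shows "sm f \<in> E_set (int_vec ` A)"
proof -
  have False if p: "p \<noteq> 0" "\<forall>x\<in>int_vec ` A. eval2 p x = 0" "lm p = sm f" for p
  proof -
    have "0 = (\<Sum>e\<in>supp p. cf p e * moment f e)"
      unfolding sum_eval2[symmetric] using p(2) assms(2) by (intro sum.neutral[symmetric]) auto
    also have "\<dots> = (\<Sum>e\<in>{lm p}. cf p e * moment f e)"
      by (rule sum.mono_neutral_right)
        (use lm_props[OF p(1)] moment_below_sm[OF assms(1)] p(3) in auto)
    finally show False
      using lm_props(1)[OF p(1)] moment_sm[OF assms(1)] p(3) by (simp add: in_keys_iff)
  qed
  then show ?thesis unfolding E_set_def by blast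
qed

text \<open>If no combination of points of \<open>A\<close> has \<open>e\<close> as its smallest
  exponent, then on \<open>A\<close> the monomial \<open>e\<close> is a combination of smaller ones
  by \<open>functional_in_span\<close>, and the difference \<open>p\<close> vanishes on
  \<open>A\<close> with leading exponent \<open>e\<close>.\<close>

lemma E_set_imp_sm:
  assumes "finite A" "e \<in> E_set (int_vec ` A)"
  obtains f where "f \<noteq> 0" "supp f \<subseteq> A" "sm f = e"
proof -
  let ?J = "{e'. deglex_less e' e}"
  let ?c = "\<lambda>e a. monomial_at e (int_vec a)"
  have "\<exists>u. (\<forall>e'\<in>?J. (\<Sum>a\<in>A. ?c e' a * u a) = 0) \<and> (\<Sum>a\<in>A. ?c e a * u a) \<noteq> 0"
  proof (rule ccontr)
    assume *: "\<not> ?thesis"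
    have "\<exists>l. \<forall>a\<in>A. ?c e a = (\<Sum>e'\<in>?J. l e' * ?c e' a)"
      by (rule functional_in_span[OF finite_deglex_less assms(1)]) (use * in blast)
    then obtain l where l: "\<forall>a\<in>A. ?c e a = (\<Sum>e'\<in>?J. l e' * ?c e' a)" by blast
    define p where "p = sgl e 1 - (\<Sum>e'\<in>?J. sgl e' (l e'))"
    have cf_p: "cf p e' = (if e' = e then 1 else if deglex_less e' e then - l e' else 0)" for e'
      by (simp add: p_def lookup_minus cf_sum_single finite_deglex_less lookup_single when_def)
    have supp: "supp p \<subseteq> insert e ?J" by (auto simp: in_keys_iff cf_p split: if_splits)
    have "e \<in> supp p" by (simp add: in_keys_iff cf_p)
    then have "lm p = e" by (rule lm_eqI) (use supp in auto)
    moreover have "p \<noteq> 0" using \<open>e \<in> supp p\<close> by auto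
    moreover have "eval2 p (int_vec a) = 0" if "a \<in> A" for a
    proof -
      have "eval2 p (int_vec a) = (\<Sum>e'\<in>insert e ?J. cf p e' * ?c e' a)"
        unfolding eval2_def
        by (rule sum.mono_neutral_left) (use supp finite_deglex_less in \<open>auto simp: in_keys_iff\<close>)
      also have "\<dots> = ?c e a + (\<Sum>e'\<in>?J. cf p e' * ?c e' a)"
        by (simp add: finite_deglex_less cf_p)
      also have "(\<Sum>e'\<in>?J. cf p e' * ?c e' a) = (\<Sum>e'\<in>?J. - (l e' * ?c e' a))"
        by (rule sum.cong) (auto simp: cf_p)
      also have "\<dots> = - ?c e a" using l that by (simp add: sum_negf)
      finally show ?thesis by simp
    qed
    ultimately show False using assms(2) unfolding E_set_def by blast
  qed
  then obtain u where u: "\<forall>e'\<in>?J. (\<Sum>a\<in>A. ?c e' a * u a) = 0" "(\<Sum>a\<in>A. ?c e a * u a) \<noteq> 0" by blast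
  define f where "f = (\<Sum>a\<in>A. sgl a (u a))"
  have m: "moment f e' = (\<Sum>a\<in>A. ?c e' a * u a)" for e'
    by (simp add: f_def moment_sum_single mult.commute)
  have "f \<noteq> 0" using m[of e] u(2) by (auto simp: moment_def)
  moreover have "supp f \<subseteq> A" by (auto simp: f_def in_keys_iff cf_sum_single assms(1) split: if_splits)
  moreover have "sm f = e" by (rule sm_eqI) (use m u in auto)
  ultimately show thesis using that by blast
qed

text \<open>With fewer standard exponents than points, some nonzero function on \<open>A\<close>
  would have vanishing moments at all of them, yet its own smallest exponent is standard.\<close>

lemma card_le_card_E_set:
  assumes "finite A" "finite (E_set (int_vec ` A))"
  shows "card A \<le> card (E_set (int_vec ` A))"
proof (rule ccontr)
  assume "\<not> ?thesis"
  then obtain u where u: "\<exists>a\<in>A. u a \<noteq> 0"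
    "\<forall>e\<in>E_set (int_vec ` A). (\<Sum>a\<in>A. monomial_at e (int_vec a) * u a) = 0"
    using underdetermined_system[OF assms(2,1), of "\<lambda>e a. monomial_at e (int_vec a)"] by force
  define f where "f = (\<Sum>a\<in>A. sgl a (u a))"
  have cf_f: "cf f a = (if a \<in> A then u a else 0)" for a
    by (simp add: f_def cf_sum_single assms(1))
  have "f \<noteq> 0" using u(1) cf_f by (metis lookup_zero)
  moreover have "supp f \<subseteq> A" by (auto simp: in_keys_iff cf_f split: if_splits)
  ultimately have "sm f \<in> E_set (int_vec ` A)" by (rule sm_in_E_set)
  then have "moment f (sm f) = 0" using u(2) by (simp add: f_def moment_sum_single mult.commute)
  with moment_sm[OF \<open>f \<noteq> 0\<close>] show False by contradiction
qed

subsection \<open>Irreducible lattice functions are prime\<close>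

text \<open>Horner evaluation at \<open>y\<close> after applying \<open>h\<close> to the
  coefficients. It is used twice, nested, so \<open>h\<close> may itself be such an
  evaluation.\<close>

definition subst_poly :: "('a::comm_ring_1 \<Rightarrow> 'b::comm_ring_1) \<Rightarrow> 'b \<Rightarrow> 'a poly \<Rightarrow> 'b" where
  "subst_poly h y p = fold_coeffs (\<lambda>a r. h a + y * r) p 0"

definition ring_hom1 :: "('a::comm_ring_1 \<Rightarrow> 'b::comm_ring_1) \<Rightarrow> bool" where
  "ring_hom1 h \<longleftrightarrow> h 0 = 0 \<and> h 1 = 1 \<and> (\<forall>a b. h (a + b) = h a + h b) \<and> (\<forall>a b. h (a * b) = h a * h b)"

lemma ring_hom1D:
  assumes "ring_hom1 h"
  shows "h 0 = 0" "h 1 = 1" "h (a + b) = h a + h b" "h (a * b) = h a * h b"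
  using assms by (auto simp: ring_hom1_def)

lemma subst_poly_0 [simp]: "subst_poly h y 0 = 0"
  by (simp add: subst_poly_def)

lemma subst_poly_pCons:
  "ring_hom1 h \<Longrightarrow> subst_poly h y (pCons a p) = h a + y * subst_poly h y p"
  by (cases "a = 0 \<and> p = 0") (auto simp: subst_poly_def ring_hom1D)

lemma subst_poly_add:
  assumes "ring_hom1 h"
  shows "subst_poly h y (p + q) = subst_poly h y p + subst_poly h y q"
  by (induction p q rule: poly_induct2)
    (auto simp: subst_poly_pCons assms ring_hom1D[OF assms] algebra_simps)

lemma subst_poly_smult:
  assumes "ring_hom1 h"
  shows "subst_poly h y (smult a p) = h a * subst_poly h y p"
  by (induction p) (auto simp: subst_poly_pCons assms ring_hom1D[OF assms] algebra_simps)

lemma subst_poly_mult: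
  assumes "ring_hom1 h"
  shows "subst_poly h y (p * q) = subst_poly h y p * subst_poly h y q"
  by (induction p)
    (auto simp: subst_poly_pCons subst_poly_add subst_poly_smult assms ring_hom1D[OF assms] algebra_simps)

lemma ring_hom1_subst_poly: "ring_hom1 h \<Longrightarrow> ring_hom1 (subst_poly h y)"
  by (subst ring_hom1_def)
    (auto simp: subst_poly_add subst_poly_mult subst_poly_pCons ring_hom1D one_pCons)

lemma ring_hom1_sgl_0: "ring_hom1 (sgl (0::'a::comm_monoid_add) :: 'b::comm_ring_1 \<Rightarrow> _)"
  by (auto simp: ring_hom1_def mult_single single_add)

text \<open>Nested univariate polynomials serve as the source because they are available as a
  factorial ring. The outer variable becomes the second coordinate.\<close>

definition lattice_of_poly :: "real poly poly \<Rightarrow> lattice_fun" where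
  "lattice_of_poly = subst_poly (subst_poly (sgl 0) (sgl (1, 0) 1)) (sgl (0, 1) 1)"

lemma hom_inner: "ring_hom1 (subst_poly (sgl 0) (sgl (1, 0) 1 :: lattice_fun) :: real poly \<Rightarrow> _)"
  by (intro ring_hom1_subst_poly ring_hom1_sgl_0)

lemma hom_lattice_of_poly: "ring_hom1 lattice_of_poly"
  unfolding lattice_of_poly_def by (intro ring_hom1_subst_poly hom_inner)

lemmas lattice_of_poly_simps = ring_hom1D[OF hom_lattice_of_poly]

lemma cf_sgl_mult: "cf (sgl a x * g) c = x * cf (g :: lattice_fun) (c - a)"
  by (simp add: cf_mult_superset[of "{a}"])

lemma cf_inner:
  "cf (subst_poly (sgl 0) (sgl (1, 0) 1 :: lattice_fun) p) (i, j) =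
    (if j = 0 \<and> 0 \<le> i then coeff p (nat i) else 0)"
proof (induction p arbitrary: i j)
  case (pCons a p)
  have "coeff (pCons a p) (nat i) = (if i = 0 then a else coeff p (nat (i - 1)))" if "0 \<le> i"
  proof (cases "i = 0")
    case False
    then have "nat i = Suc (nat (i - 1))" using that by simp
    then show ?thesis using False by simp
  qed simp
  moreover have "(0 = (i, j)) = (i = 0 \<and> j = 0)" by (auto simp: zero_prod_def)
  ultimately show ?case
    by (auto simp: subst_poly_pCons ring_hom1_sgl_0 lookup_add cf_sgl_mult pCons.IH lookup_single
        when_def)
qed simp

lemma cf_lattice_of_poly:
  "cf (lattice_of_poly p) (i, j) = (if 0 \<le> i \<and> 0 \<le> j then coeff (coeff p (nat j)) (nat i) else 0)"
proof (induction p arbitrary: i j)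
  case (pCons a p)
  have "coeff (pCons a p) (nat j) = (if j = 0 then a else coeff p (nat (j - 1)))" if "0 \<le> j"
  proof (cases "j = 0")
    case False
    then have "nat j = Suc (nat (j - 1))" using that by simp
    then show ?thesis using False by simp
  qed simp
  moreover have "lattice_of_poly (pCons a p) =
      subst_poly (sgl 0) (sgl (1, 0) 1) a + sgl (0, 1) 1 * lattice_of_poly p"
    unfolding lattice_of_poly_def by (rule subst_poly_pCons[OF hom_inner])
  ultimately show ?case
    by (auto simp: lookup_add cf_sgl_mult pCons.IH cf_inner)
qed (simp add: lattice_of_poly_def)

lemma lattice_of_poly_inj: "lattice_of_poly p = lattice_of_poly q \<longleftrightarrow> p = q"
proof
  assume *: "lattice_of_poly p = lattice_of_poly q"
  show "p = q"
  proof (intro poly_eqI)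
    fix i j show "coeff (coeff p j) i = coeff (coeff q j) i"
      using cf_lattice_of_poly[of p "int i" "int j"] cf_lattice_of_poly[of q "int i" "int j"] *
      by simp
  qed
qed simp

lemma lattice_of_poly_monom:
  "lattice_of_poly (monom (monom c i) j) = sgl (int i, int j) c"
proof (rule poly_mapping_eqI)
  fix a show "cf (lattice_of_poly (monom (monom c i) j)) a = cf (sgl (int i, int j) c) a"
    by (cases a) (auto simp: cf_lattice_of_poly lookup_single when_def)
qed

section \<open>Units of the Laurent ring, clearing denominators, primality\<close>

definition diag_shift :: "nat \<Rightarrow> lattice_fun" where
  "diag_shift n = sgl (int n, int n) 1"

lemma diag_shift_add: "diag_shift (m + n) = diag_shift m * diag_shift n"
  by (simp add: diag_shift_def mult_single)

lemma unit_mult_dvd_iff: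
  fixes u f g :: "'a::comm_semiring_1"
  assumes "u dvd 1"
  shows "u * f dvd g \<longleftrightarrow> f dvd g"
proof
  assume "f dvd g"
  with assms have "u * f dvd 1 * g" by (intro mult_dvd_mono)
  then show "u * f dvd g" by simp
qed (rule dvd_mult_right)

lemma dvd_unit_mult_iff:
  fixes u f g :: "'a::comm_semiring_1"
  assumes "u dvd 1"
  shows "f dvd u * g \<longleftrightarrow> f dvd g"
proof
  assume *: "f dvd u * g"
  from assms obtain v where "1 = u * v" by (elim dvdE)
  then have "g = v * (u * g)" by (metis mult.assoc mult.commute mult_1_right)
  with * show "f dvd g" by (metis dvd_mult)
qed simp

lemma irreducible_unit_multD:
  fixes u f :: "'a::comm_semiring_1"
  assumes "u dvd 1" "irreducible f"
  shows "irreducible (u * f)"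
proof -
  from assms(1) obtain v where v: "1 = u * v" by (elim dvdE)
  have f: "f = v * (u * f)" using v by (metis mult.assoc mult.commute mult_1_right)
  show ?thesis
  proof (rule irreducibleI)
    show "u * f \<noteq> 0" using assms(2) f by (metis irreducible_not_unit irreducible_def mult_zero_right)
    show "\<not> u * f dvd 1" using assms unit_mult_dvd_iff by (metis irreducible_not_unit)
    fix a b assume "u * f = a * b"
    then have "f = (v * a) * b" using f by (metis mult.assoc)
    then have "v * a dvd 1 \<or> b dvd 1" using assms(2) by (metis irreducibleD)
    then show "a dvd 1 \<or> b dvd 1" by (metis dvd_mult_right)
  qed
qed

lemma irreducible_unit_cancel:
  fixes u f :: "'a::comm_semiring_1"
  assumes "u dvd 1" "irreducible (u * f)"
  shows "irreducible f"
proof -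
  from assms(1) obtain v where v: "1 = u * v" by (elim dvdE)
  then have "v dvd 1" by (metis dvd_triv_right)
  then have "irreducible (v * (u * f))" using assms(2) by (rule irreducible_unit_multD)
  then show ?thesis using v by (metis mult.assoc mult.commute mult_1_right)
qed

lemma sgl_unit: "x \<noteq> 0 \<Longrightarrow> sgl a x dvd (1 :: lattice_fun)"
  by (rule dvdI[of _ _ "sgl (- a) (1 / x)"]) (simp add: mult_single)

lemma diag_shift_poly: "diag_shift n = lattice_of_poly (monom (monom 1 n) n)"
  by (simp add: lattice_of_poly_monom diag_shift_def)

lemma clear_denominators:
  fixes f :: lattice_fun
  shows "\<exists>n p. diag_shift n * f = lattice_of_poly p"
proof -
  have "\<exists>n p. diag_shift n * (\<Sum>a\<in>A. sgl a (u a)) = lattice_of_poly p" for A and u :: "int \<times> int \<Rightarrow> real"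
  proof (induction A rule: infinite_finite_induct)
    case (insert a A)
    then obtain n p where p: "diag_shift n * (\<Sum>a\<in>A. sgl a (u a)) = lattice_of_poly p" by blast
    obtain i j where a: "a = (i, j)" by (cases a)
    \<comment> \<open>Large enough for the diagonal shift to make both coordinates of
      \<open>a\<close> nonnegative.\<close>
    define m where "m = nat \<bar>i\<bar> + nat \<bar>j\<bar>"
    have "0 \<le> int m + i" "0 \<le> int m + j" by (auto simp: m_def)
    then have e1: "diag_shift m * sgl a (u a) = lattice_of_poly (monom (monom (u a) (nat (int m + i))) (nat (int m + j)))"
      by (simp add: lattice_of_poly_monom diag_shift_def mult_single a)
    have "diag_shift (n + m) * (\<Sum>a\<in>insert a A. sgl a (u a)) =
       diag_shift n * (diag_shift m * sgl a (u a)) + diag_shift m * (diag_shift n * (\<Sum>a\<in>A. sgl a (u a)))"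
      using insert.hyps by (simp add: diag_shift_add algebra_simps)
    then have "diag_shift (n + m) * (\<Sum>a\<in>insert a A. sgl a (u a)) =
       lattice_of_poly (monom (monom 1 n) n * monom (monom (u a) (nat (int m + i))) (nat (int m + j))
         + monom (monom 1 m) m * p)"
      unfolding e1 p by (simp add: lattice_of_poly_simps diag_shift_poly)
    then show ?case by blast
  qed (auto intro: exI[of _ 0] simp: lattice_of_poly_simps)
  from this[of "cf f" "supp f"] show ?thesis by (simp add: sum_single_cf)
qed

text \<open>Induction along a prime factorization of \<open>p\<close>: as the image is irreducible,
  one of the two factors becomes a unit each time, and up to units a single prime remains.\<close>

lemma irreducible_associated_prime:
  assumes "irreducible (lattice_of_poly p)"
  shows "\<exists>q u. prime_elem q \<and> u dvd 1 \<and> lattice_of_poly q * u = lattice_of_poly p"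
  using assms
proof (induction p rule: prime_divisors_induct)
  case zero
  then show ?case by (simp add: lattice_of_poly_simps irreducible_def)
next
  case (unit x)
  then obtain y where "1 = x * y" by (elim dvdE)
  then have "1 = lattice_of_poly x * lattice_of_poly y" by (metis lattice_of_poly_simps(2,4))
  then have "(lattice_of_poly x) dvd 1" by (rule dvdI)
  with unit show ?case by (simp add: irreducible_def)
next
  case (factor p x)
  then consider "(lattice_of_poly x) dvd 1" | "(lattice_of_poly p) dvd 1"
    by (metis irreducibleD lattice_of_poly_simps(4))
  then show ?case
  proof cases
    case 1
    then show ?thesis using factor by (metis lattice_of_poly_simps(4) prime_imp_prime_elem)
  next
    case 2
    then have "irreducible (lattice_of_poly x)"
      using factor.prems irreducible_unit_cancel[of "lattice_of_poly p" "lattice_of_poly x"]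
      by (simp add: lattice_of_poly_simps)
    with factor obtain q u where "prime_elem q" "u dvd 1" "lattice_of_poly q * u = lattice_of_poly x"
      by blast
    moreover have "(u * lattice_of_poly p) dvd 1"
      using 2 \<open>u dvd 1\<close> by (metis mult_1_left mult_dvd_mono)
    moreover have "lattice_of_poly (p * x) = lattice_of_poly q * (u * lattice_of_poly p)"
      using \<open>lattice_of_poly q * u = lattice_of_poly x\<close>
      by (simp add: lattice_of_poly_simps mult_ac flip: \<open>lattice_of_poly q * u = lattice_of_poly x\<close>)
    ultimately show ?thesis by metis
  qed
qed

text \<open>Multiplying everything by diagonal monomials pulls the divisibility back along the
  injective \<open>lattice_of_poly\<close>, where \<open>f\<close> is represented by a prime. This
  prime cannot divide a diagonal monomial, or \<open>f\<close> would be a unit.\<close>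

lemma irreducible_imp_prime_lattice:
  fixes f :: lattice_fun
  assumes f: "irreducible f" and "f dvd g * h"
  shows "f dvd g \<or> f dvd h"
proof -
  obtain n p where p: "diag_shift n * f = lattice_of_poly p" using clear_denominators by blast
  have unit: "(diag_shift n) dvd 1" for n unfolding diag_shift_def by (rule sgl_unit) simp
  have "irreducible (lattice_of_poly p)"
    unfolding p[symmetric] using f unit irreducible_unit_multD by blast
  then obtain q u where q: "prime_elem q" "u dvd 1" "lattice_of_poly q * u = lattice_of_poly p"
    using irreducible_associated_prime by blast
  have f_dvd: "lattice_of_poly q dvd x \<longleftrightarrow> f dvd x" for x
    by (metis unit_mult_dvd_iff mult.commute p q(2,3) unit)
  obtain s where s: "g * h = lattice_of_poly q * s" using assms(2) f_dvd by (metis dvdE)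
  obtain i g' where g': "diag_shift i * g = lattice_of_poly g'" using clear_denominators by blast
  obtain j h' where h': "diag_shift j * h = lattice_of_poly h'" using clear_denominators by blast
  obtain k s' where s': "diag_shift k * s = lattice_of_poly s'" using clear_denominators by blast
  let ?D = "\<lambda>n. monom (monom 1 n) n :: real poly poly"
  have "lattice_of_poly (?D k * (g' * h')) = diag_shift k * (diag_shift i * g * (diag_shift j * h))"
    by (simp add: lattice_of_poly_simps g' h' diag_shift_poly[symmetric])
  also have "\<dots> = diag_shift k * diag_shift (i + j) * (g * h)"
    by (simp add: diag_shift_add mult_ac)
  also have "\<dots> = lattice_of_poly q * (diag_shift k * s * diag_shift (i + j))"
    unfolding s by (simp add: mult_ac)
  also have "\<dots> = lattice_of_poly (q * (s' * ?D (i + j)))"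
    by (simp add: lattice_of_poly_simps s' diag_shift_poly[symmetric])
  finally have "q dvd ?D k * (g' * h')" unfolding lattice_of_poly_inj by (rule dvdI)
  then consider "q dvd ?D k" | "q dvd g'" | "q dvd h'"
    using q(1) by (metis prime_elem_dvd_mult_iff)
  moreover have dvd: "lattice_of_poly a dvd lattice_of_poly b" if "a dvd b" for a b
    using that by (metis dvd_def lattice_of_poly_simps(4))
  ultimately show ?thesis
  proof cases
    case 1
    then have "f dvd diag_shift k" using dvd f_dvd by (metis diag_shift_poly)
    then have "f dvd 1" using unit dvd_trans by blast
    with f show ?thesis by (simp add: irreducible_def)
  next
    case 2
    then have "f dvd diag_shift i * g" using dvd f_dvd g' by metis
    then show ?thesis using unit by (metis dvd_unit_mult_iff)
  next
    case 3
    then have "f dvd diag_shift j * h" using dvd f_dvd h' by metis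
    then show ?thesis using unit by (metis dvd_unit_mult_iff)
  qed
qed

subsection \<open>Counting lattice points in homothetic copies of a convex set\<close>

definition homothet :: "real \<Rightarrow> real \<times> real \<Rightarrow> (real \<times> real) set \<Rightarrow> (real \<times> real) set" where
  "homothet t u P = (\<lambda>x. t *\<^sub>R x + u) ` P"

text \<open>By convexity the Minkowski sum of two copies is again inside a copy, and the scales add.
  All lattice counts below use this to enlarge or shrink a copy by a fixed amount.\<close>

lemma homothet_add:
  assumes "convex P" "0 \<le> s" "0 \<le> t" "x \<in> homothet s u P" "y \<in> homothet t v P"
  shows "x + y \<in> homothet (s + t) (u + v) P"
proof -
  obtain a b where a: "a \<in> P" "x = s *\<^sub>R a + u" and b: "b \<in> P" "y = t *\<^sub>R b + v"
    using assms by (auto simp: homothet_def)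
  show ?thesis
  proof (cases "s + t = 0")
    case True
    then have "s = 0" "t = 0" using assms by auto
    then show ?thesis using a b by (auto simp: homothet_def)
  next
    case False
    then have pos: "s + t > 0" using assms by auto
    define c where "c = (s / (s + t)) *\<^sub>R a + (t / (s + t)) *\<^sub>R b"
    have "c \<in> P" unfolding c_def
      by (rule convexD[OF assms(1) a(1) b(1)]) (use assms pos in \<open>auto simp flip: add_divide_distrib\<close>)
    moreover have "(s + t) *\<^sub>R c = s *\<^sub>R a + t *\<^sub>R b"
      using pos by (simp add: c_def scaleR_right_distrib)
    then have "x + y = (s + t) *\<^sub>R c + (u + v)" using a b by simp
    ultimately show ?thesis by (auto simp: homothet_def)
  qed
qed

lemma measure_homothet: "0 \<le> t \<Longrightarrow> measure lebesgue (homothet t u P) = t\<^sup>2 * measure lebesgue P"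
  unfolding homothet_def measure_lebesgue_affine by (simp add: power2_eq_square)

lemma compact_homothet: "compact P \<Longrightarrow> compact (homothet t u P)"
  unfolding homothet_def by (intro compact_continuous_image continuous_intros)

text \<open>The factor \<open>c\<close> is the price in scale for moving by up to one unit in each
  coordinate; it controls all boundary errors.\<close>

lemma interior_homothet_square:
  assumes "interior P \<noteq> {}"
  obtains c y where "0 < c" "cbox (-1, -1) (1, 1) \<subseteq> homothet c y P"
proof -
  from assms obtain z where "z \<in> interior P" by blast
  then obtain r where r: "r > 0" "ball z r \<subseteq> P" by (auto simp: mem_interior)
  \<comment> \<open>Points of the square have squared norm at most 2, hence norm below 2, so scaling
    by \<open>r / 2\<close> moves them into the ball.\<close>
  have "cbox (-1, -1) (1, 1 :: real) \<subseteq> homothet (2 / r) (- ((2 / r) *\<^sub>R z)) P"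
  proof
    fix x :: "real \<times> real" assume x: "x \<in> cbox (-1, -1) (1, 1)"
    obtain a b where ab: "x = (a, b)" by (cases x)
    have "\<bar>a\<bar> \<le> 1" "\<bar>b\<bar> \<le> 1" using x by (auto simp: ab mem_box cbox_Pair_eq)
    then have "a\<^sup>2 \<le> 1" "b\<^sup>2 \<le> 1" by (auto simp: abs_square_le_1)
    then have "(norm x)\<^sup>2 \<le> 2" by (simp add: ab norm_Pair)
    moreover have "(2::real) < 2\<^sup>2" by simp
    ultimately have "norm x < 2" by (metis le_less_trans norm_ge_zero power2_less_imp_less zero_le_numeral)
    then have "z + (r / 2) *\<^sub>R x \<in> ball z r" using r(1) by (simp add: dist_norm)
    then have "z + (r / 2) *\<^sub>R x \<in> P" using r by blast
    moreover have "x = (2 / r) *\<^sub>R (z + (r / 2) *\<^sub>R x) + - ((2 / r) *\<^sub>R z)"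
      using r(1) by (simp add: scaleR_right_distrib)
    ultimately show "x \<in> homothet (2 / r) (- ((2 / r) *\<^sub>R z)) P" unfolding homothet_def by blast
  qed
  then show thesis using that r(1) by (metis divide_pos_pos zero_less_numeral)
qed

lemma int_vec_add: "int_vec (a + b) = int_vec a + int_vec b"
  by (simp add: int_vec_def)

lemma mem_box_Pair: "(x, y) \<in> box (a, b) (c, d) \<longleftrightarrow> a < x \<and> x < c \<and> b < y \<and> y < (d::real)" for x :: real
  by (auto simp: mem_box Basis_prod_def ball_Un)

lemma mem_cbox_Pair: "(x, y) \<in> cbox (a, b) (c, d) \<longleftrightarrow> a \<le> x \<and> x \<le> c \<and> b \<le> y \<and> y \<le> (d::real)" for x :: real
  by (auto simp: cbox_Pair_eq)

text \<open>Open, so that distinct cells are disjoint; the covering argument of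
  \<open>card_lattice_lower\<close> uses closed cells instead.\<close>

definition unit_cell :: "int \<times> int \<Rightarrow> (real \<times> real) set" where
  "unit_cell a = box (int_vec a) (int_vec a + (1, 1))"

lemma measure_unit_cell: "measure lebesgue (unit_cell a) = 1"
  unfolding unit_cell_def
  by (cases a) (simp add: measure_lborel_box_eq int_vec_def Basis_prod_def prod.union_disjoint)

lemma unit_cell_disjoint:
  assumes "x \<in> unit_cell a" "x \<in> unit_cell b"
  shows "a = b"
proof -
  obtain x1 x2 where x: "x = (x1, x2)" by (cases x)
  have "\<lfloor>x1\<rfloor> = fst c \<and> \<lfloor>x2\<rfloor> = snd c" if "x \<in> unit_cell c" for c
    using that by (auto simp: unit_cell_def int_vec_def x mem_box_Pair floor_eq_iff)
  from this[OF assms(1)] this[OF assms(2)] show ?thesis by (simp add: prod_eq_iff)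
qed

lemma card_le_measure:
  assumes "finite X" "S \<in> lmeasurable" "\<And>a. a \<in> X \<Longrightarrow> unit_cell a \<subseteq> S"
  shows "real (card X) \<le> measure lebesgue S"
proof -
  have "measure lebesgue (\<Union>a\<in>X. unit_cell a) = (\<Sum>a\<in>X. measure lebesgue (unit_cell a))"
    using assms(1) by (intro measure_UNION')
      (auto simp: unit_cell_def[of "_"] pairwise_def disjnt_iff dest: unit_cell_disjoint[unfolded unit_cell_def])
  also have "\<dots> = real (card X)" by (simp add: measure_unit_cell)
  finally have "real (card X) = measure lebesgue (\<Union>a\<in>X. unit_cell a)" ..
  also have "\<dots> \<le> measure lebesgue S"
    using assms by (intro measure_mono_fmeasurable) (auto simp: unit_cell_def intro!: sets.finite_UN)
  finally show ?thesis .
qed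

lemma finite_lattice_points:
  assumes "bounded S"
  shows "finite {a. int_vec a \<in> S}"
proof -
  obtain B where B: "\<And>x. x \<in> S \<Longrightarrow> norm x \<le> B" using assms by (auto simp: bounded_iff)
  have "{a. int_vec a \<in> S} \<subseteq> {-\<lceil>B\<rceil>..\<lceil>B\<rceil>} \<times> {-\<lceil>B\<rceil>..\<lceil>B\<rceil>}"
  proof
    fix a assume "a \<in> {a. int_vec a \<in> S}"
    then have n: "norm (int_vec a) \<le> B" using B by simp
    have "norm (real_of_int (fst a)) \<le> norm (int_vec a)" "norm (real_of_int (snd a)) \<le> norm (int_vec a)"
      unfolding int_vec_def by (rule norm_fst_le norm_snd_le)+
    with n have "\<bar>real_of_int (fst a)\<bar> \<le> B" "\<bar>real_of_int (snd a)\<bar> \<le> B" by simp_all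
    then show "a \<in> {-\<lceil>B\<rceil>..\<lceil>B\<rceil>} \<times> {-\<lceil>B\<rceil>..\<lceil>B\<rceil>}"
      by (cases a) (auto; linarith)
  qed
  then show ?thesis by (rule finite_subset) auto
qed

lemma unit_cell_subset_homothet:
  assumes P: "convex P" and sq: "cbox (-1, -1) (1, 1) \<subseteq> homothet c y P" "0 \<le> c"
    and "0 \<le> t" "int_vec a \<in> homothet t u P"
  shows "unit_cell a \<subseteq> homothet (t + c) (u + y) P"
proof
  fix x assume x: "x \<in> unit_cell a"
  obtain x1 x2 where x12: "x = (x1, x2)" by (cases x)
  have "x - int_vec a \<in> cbox (-1, -1) (1, 1)"
    using x by (auto simp: unit_cell_def int_vec_def x12 mem_box_Pair mem_cbox_Pair)
  with sq have "x - int_vec a \<in> homothet c y P" by blast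
  from homothet_add[OF P assms(4) sq(2) assms(5) this] show "x \<in> homothet (t + c) (u + y) P"
    by simp
qed

text \<open>The cells at the counted points are disjoint and lie in a copy that is larger by
  \<open>c\<close>.\<close>

lemma card_lattice_upper:
  assumes "convex P" "compact P" "cbox (-1, -1) (1, 1) \<subseteq> homothet c y P" "0 \<le> c" "0 \<le> t"
  shows "real (card {a. int_vec a \<in> homothet t u P}) \<le> (t + c)\<^sup>2 * measure lebesgue P"
proof -
  have "real (card {a. int_vec a \<in> homothet t u P}) \<le> measure lebesgue (homothet (t + c) (u + y) P)"
    using assms unit_cell_subset_homothet[OF assms(1,3,4,5)]
    by (intro card_le_measure finite_lattice_points compact_imp_bounded compact_homothet lmeasurable_compact)
      auto
  then show ?thesis using assms by (simp add: measure_homothet)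
qed

text \<open>Rounding down a point of the copy that is smaller by \<open>c\<close> leads to a counted
  point, so the closed cells at the counted points cover that smaller copy.\<close>

lemma card_lattice_lower:
  assumes P: "convex P" "compact P" and sq: "cbox (-1, -1) (1, 1) \<subseteq> homothet c y P" "0 \<le> c" "c \<le> t"
  shows "(t - c)\<^sup>2 * measure lebesgue P \<le> real (card {a. int_vec a \<in> homothet t u P})"
proof -
  let ?A = "{a. int_vec a \<in> homothet t u P}"
  have fin: "finite ?A" using P by (intro finite_lattice_points compact_imp_bounded compact_homothet)
  let ?cell = "\<lambda>a. cbox (int_vec a) (int_vec a + (1, 1))"
  have "homothet (t - c) (u - y) P \<subseteq> (\<Union>a\<in>?A. ?cell a)"
  proof
    fix x assume x: "x \<in> homothet (t - c) (u - y) P"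
    obtain x1 x2 where x12: "x = (x1, x2)" by (cases x)
    define a where "a = (\<lfloor>x1\<rfloor>, \<lfloor>x2\<rfloor>)"
    have "int_vec a - x \<in> cbox (-1, -1) (1, 1)"
      unfolding x12 a_def int_vec_def by (simp add: mem_cbox_Pair) linarith
    with sq have "int_vec a - x \<in> homothet c y P" by blast
    from homothet_add[OF P(1) _ sq(2) x this] sq have "int_vec a \<in> homothet t u P" by simp
    moreover have "x \<in> ?cell a"
      unfolding x12 a_def int_vec_def by (simp add: mem_cbox_Pair)
    ultimately show "x \<in> (\<Union>a\<in>?A. ?cell a)" by blast
  qed
  then have "measure lebesgue (homothet (t - c) (u - y) P) \<le> measure lebesgue (\<Union>a\<in>?A. ?cell a)"
    using P fin
    by (intro measure_mono_fmeasurable fmeasurableD lmeasurable_compact compact_homothet fmeasurable.finite_UN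
        lmeasurable_cbox)
  also have "\<dots> \<le> (\<Sum>a\<in>?A. measure lebesgue (?cell a))"
    using fin by (intro measure_UNION_le) auto
  also have "\<dots> = real (card ?A)"
    by (simp add: int_vec_def content_Pair)
  finally show ?thesis using sq by (simp add: measure_homothet)
qed

subsection \<open>The size of a lattice function with respect to a triangle\<close>

text \<open>The functions \<open>l i + k i\<close> are the barycentric coordinates of the triangle.\<close>

locale triangle =
  fixes P :: "(real \<times> real) set" and l :: "nat \<Rightarrow> real \<times> real \<Rightarrow> real" and k :: "nat \<Rightarrow> real"
  assumes l_linear: "\<And>i. linear (l i)"
    and sum_l: "\<And>x. (\<Sum>i<3. l i x) = 0"
    and sum_k: "(\<Sum>i<3. k i) = 1"
    and P_eq: "P = {x. \<forall>i<3. 0 \<le> l i x + k i}"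
    and l_solve: "\<And>c. (\<Sum>i<3. c i) = 0 \<Longrightarrow> \<exists>v. \<forall>i<3. l i v = c i"
    and l_inj: "\<And>x. \<forall>i<3. l i x = 0 \<Longrightarrow> x = 0"
    and compact_P: "compact P" and convex_P: "convex P"

lemma triangle_barycentric:
  assumes "\<not> collinear {p, q, r}" "P = convex hull {p, q, r}"
  shows "\<exists>l k. triangle P l k"
proof -
  obtain p1 p2 q1 q2 r1 r2 where pqr: "p = (p1, p2)" "q = (q1, q2)" "r = (r1, r2)"
    by (metis prod.exhaust)
  \<comment> \<open>Twice the signed area. The coefficients below follow Cramer's rule:
    \<open>l i x + k i\<close> is the ratio of signed areas when vertex number \<open>i\<close> is
    replaced by \<open>x\<close>.\<close>
  define D where "D = (q1 - p1) * (r2 - p2) - (q2 - p2) * (r1 - p1)"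
  have "D \<noteq> 0"
  proof
    assume D: "D = 0"
    have "collinear {0, q - p, r - p}"
    proof (cases "q1 - p1 = 0")
      case True
      show ?thesis
      proof (cases "q2 - p2 = 0")
        case True
        then show ?thesis using \<open>q1 - p1 = 0\<close> by (simp add: collinear_lemma pqr zero_prod_def)
      next
        case False
        then have "r - p = ((r2 - p2) / (q2 - p2)) *\<^sub>R (q - p)"
          using D True by (simp add: pqr D_def)
        then show ?thesis by (auto simp: collinear_lemma)
      qed
    next
      case False
      then have "r - p = ((r1 - p1) / (q1 - p1)) *\<^sub>R (q - p)"
        using D by (simp add: pqr D_def field_simps)
      then show ?thesis by (auto simp: collinear_lemma)
    qed
    then have "collinear {q, p, r}" by (subst collinear_3) (simp_all add: NO_MATCH_def)
    with assms(1) show False by (simp add: insert_commute)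
  qed
  define A :: "nat \<Rightarrow> real" where "A i = (if i = 0 then q2 - r2 else if i = 1 then r2 - p2 else p2 - q2) / D" for i
  define B :: "nat \<Rightarrow> real" where "B i = (if i = 0 then r1 - q1 else if i = 1 then p1 - r1 else q1 - p1) / D" for i
  define k :: "nat \<Rightarrow> real" where "k i = (if i = 0 then q1 * r2 - q2 * r1 else if i = 1 then r1 * p2 - r2 * p1
     else p1 * q2 - p2 * q1) / D" for i
  define l where "l i x = fst x * A i + snd x * B i" for i and x :: "real \<times> real"
  have all3: "(\<forall>i<3. Q i) \<longleftrightarrow> Q 0 \<and> Q (1::nat) \<and> Q 2" for Q :: "nat \<Rightarrow> bool"
    by (auto simp: less_Suc_eq numeral_3_eq_3 numeral_2_eq_2)
  have sum3: "(\<Sum>i<3. c i) = c 0 + c (1::nat) + c 2" for c :: "nat \<Rightarrow> real"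
    by (simp add: numeral_3_eq_3 numeral_2_eq_2)
  note vals = l_def A_def B_def k_def
  have vertex: "l 0 p + k 0 = 1" "l 1 p + k 1 = 0" "l 2 p + k 2 = 0"
     "l 0 q + k 0 = 0" "l 1 q + k 1 = 1" "l 2 q + k 2 = 0"
     "l 0 r + k 0 = 0" "l 1 r + k 1 = 0" "l 2 r + k 2 = 1"
    using \<open>D \<noteq> 0\<close> unfolding vals pqr by (simp_all add: divide_simps) (simp_all add: D_def algebra_simps)
  have lin: "linear (l i)" for i
    by (rule linearI) (simp_all add: l_def algebra_simps)
  have suml: "(\<Sum>i<3. l i x) = 0" for x
    using \<open>D \<noteq> 0\<close> by (simp add: sum3 vals divide_simps) (simp add: algebra_simps)
  have sumk: "(\<Sum>i<3. k i) = 1"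
    using \<open>D \<noteq> 0\<close> by (simp add: sum3 vals divide_simps) (simp add: D_def algebra_simps)
  have repr: "x = (l 0 x + k 0) *\<^sub>R p + (l 1 x + k 1) *\<^sub>R q + (l 2 x + k 2) *\<^sub>R r" for x
  proof -
    have "D * fst x = D * ((l 0 x + k 0) * p1 + (l 1 x + k 1) * q1 + (l 2 x + k 2) * r1)"
      "D * snd x = D * ((l 0 x + k 0) * p2 + (l 1 x + k 1) * q2 + (l 2 x + k 2) * r2)"
      using \<open>D \<noteq> 0\<close> by (simp_all add: vals divide_simps) (simp_all add: D_def algebra_simps)
    then show ?thesis using \<open>D \<noteq> 0\<close> by (simp add: prod_eq_iff pqr)
  qed
  have lcomb: "l i (u *\<^sub>R p + v *\<^sub>R q + w *\<^sub>R r) = u * l i p + v * l i q + w * l i r" for i u v w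
    by (simp add: l_def algebra_simps)
  have "P = {x. \<forall>i<3. 0 \<le> l i x + k i}"
  proof (intro set_eqI iffI)
    fix x assume "x \<in> P"
    then obtain u v w where uvw: "0 \<le> u" "0 \<le> v" "0 \<le> w" "u + v + w = 1"
      "x = u *\<^sub>R p + v *\<^sub>R q + w *\<^sub>R r"
      unfolding assms(2) convex_hull_3 by blast
    have "l i x + k i = u * (l i p + k i) + v * (l i q + k i) + w * (l i r + k i)" for i
    proof -
      have "k i = (u + v + w) * k i" using uvw by simp
      then show ?thesis unfolding uvw(5) lcomb by (simp add: algebra_simps)
    qed
    then show "x \<in> {x. \<forall>i<3. 0 \<le> l i x + k i}" using uvw vertex by (simp add: all3)
  next
    fix x assume "x \<in> {x. \<forall>i<3. 0 \<le> l i x + k i}"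
    then have "0 \<le> l 0 x + k 0" "0 \<le> l 1 x + k 1" "0 \<le> l 2 x + k 2" by (auto simp: all3)
    moreover have "(l 0 x + k 0) + (l 1 x + k 1) + (l 2 x + k 2) = 1"
      using suml[of x] sumk by (simp add: sum3)
    ultimately show "x \<in> P" unfolding assms(2) convex_hull_3 using repr[of x] by blast
  qed
  moreover have "\<exists>v. \<forall>i<3. l i v = c i" if "(\<Sum>i<3. c i) = 0" for c
  proof -
    have c: "c 2 = - c 0 - c 1" using that by (simp add: sum3)
    have "l i p = (if i = 0 then 1 - k i else - k i)" "l i q = (if i = 1 then 1 - k i else - k i)"
      "l i r = (if i = 2 then 1 - k i else - k i)" if "i \<in> {0, 1, 2}" for i
      using vertex that by auto
    then have "\<forall>i<3. l i (c 0 *\<^sub>R p + c 1 *\<^sub>R q + c 2 *\<^sub>R r) = c i"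
      unfolding lcomb by (simp add: all3 c algebra_simps)
    then show ?thesis by blast
  qed
  moreover have "x = 0" if "\<forall>i<3. l i x = 0" for x
  proof -
    have "l i (x + p) = l i p" if "i < 3" for i
      using lin[of i] \<open>\<forall>i<3. l i x = 0\<close> that by (simp add: linear_add)
    then have "x + p = p" using repr[of "x + p"] repr[of p] by simp
    then show ?thesis by simp
  qed
  moreover have "compact P" "convex P" unfolding assms(2) by (simp_all add: compact_convex_hull finite_imp_compact)
  ultimately have "triangle P l k" using lin suml sumk by (intro triangle.intro; blast)
  then show ?thesis by blast
qed

context triangle
begin

lemma P_interior: "interior P \<noteq> {}"
proof -
  \<comment> \<open>The point sought is the barycenter, with all three coordinates
    \<open>1 / 3\<close>.\<close>
  have "(\<Sum>i<3. 1 / 3 - k i) = 0" using sum_k by (simp add: sum_subtractf)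
  then obtain v where "\<forall>i<3. l i v = 1 / 3 - k i" using l_solve by blast
  then have "v \<in> (\<Inter>i\<in>{..<3}. {x. 0 < l i x + k i})" by simp
  moreover have "open (\<Inter>i\<in>{..<3}. {x. 0 < l i x + k i})"
    using l_linear by (intro open_INT finite_lessThan ballI open_Collect_less continuous_intros
        linear_continuous_on linear_conv_bounded_linear[THEN iffD1]) auto
  moreover have "(\<Inter>i\<in>{..<3}. {x. 0 < l i x + k i}) \<subseteq> P" by (auto simp: P_eq less_imp_le)
  ultimately show ?thesis using interior_maximal by blast
qed

lemma P_nonempty: "P \<noteq> {}"
  using P_interior by auto

lemma vol_P_pos: "0 < measure lebesgue P"
proof -
  obtain c y where c: "0 < c" "cbox (-1, -1) (1, 1) \<subseteq> homothet c y P"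
    using interior_homothet_square[OF P_interior] by blast
  have "measure lborel (cbox (-1) (1 :: real)) = 2" unfolding box_real by simp
  then have "4 = measure lebesgue (cbox (-1, -1) (1 :: real, 1 :: real))" by (simp add: content_Pair)
  also have "\<dots> \<le> measure lebesgue (homothet c y P)"
    by (rule measure_mono_fmeasurable[OF c(2) fmeasurableD[OF lmeasurable_cbox]
          lmeasurable_compact[OF compact_homothet[OF compact_P]]])
  also have "\<dots> = c\<^sup>2 * measure lebesgue P" using c by (simp add: measure_homothet)
  finally show ?thesis using c(1) by (smt (verit) mult_nonneg_nonpos zero_le_power2)
qed

lemma mem_homothet:
  assumes "0 \<le> t"
  shows "x \<in> homothet t u P \<longleftrightarrow> (\<forall>i<3. l i u - t * k i \<le> l i x)"
proof
  assume "x \<in> homothet t u P"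
  then obtain y where y: "y \<in> P" "x = t *\<^sub>R y + u" by (auto simp: homothet_def)
  show "\<forall>i<3. l i u - t * k i \<le> l i x"
  proof (intro allI impI)
    fix i :: nat assume "i < 3"
    then have "0 \<le> t * (l i y + k i)" using y(1) assms by (simp add: P_eq)
    then show "l i u - t * k i \<le> l i x"
      using l_linear[of i] by (simp add: y(2) linear_add linear_scale algebra_simps)
  qed
next
  assume x: "\<forall>i<3. l i u - t * k i \<le> l i x"
  have diff: "l i (x - u) = l i x - l i u" for i using l_linear by (simp add: linear_diff)
  show "x \<in> homothet t u P"
  proof (cases "t = 0")
    \<comment> \<open>A copy of scale 0 is a point: three nonnegative numbers with sum zero vanish,
      and \<open>l_inj\<close> applies.\<close>
    case True
    then have "\<forall>i\<in>{..<3}. 0 \<le> l i (x - u)" using x by (simp add: diff)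
    then have "\<forall>i\<in>{..<3}. l i (x - u) = 0"
      using sum_nonneg_eq_0_iff[of "{..<3}" "\<lambda>i. l i (x - u)"] sum_l[of "x - u"] by simp
    then have "x - u = 0" by (intro l_inj) simp
    moreover obtain y where "y \<in> P" using P_nonempty by blast
    ultimately show ?thesis using True by (auto simp: homothet_def)
  next
    case False
    with assms have "t > 0" by simp
    have "(1 / t) *\<^sub>R (x - u) \<in> P"
      unfolding P_eq
    proof (intro CollectI allI impI)
      fix i :: nat assume "i < 3"
      then have "0 \<le> l i (x - u) + t * k i" using x[rule_format, of i] by (simp add: diff)
      then have "0 \<le> (l i (x - u) + t * k i) / t" using \<open>t > 0\<close> by (rule divide_nonneg_pos)
      also have "\<dots> = l i ((1 / t) *\<^sub>R (x - u)) + k i"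
        using \<open>t > 0\<close> linear_scale[OF l_linear, of i "1 / t" "x - u"] by (simp add: add_divide_distrib)
      finally show "0 \<le> l i ((1 / t) *\<^sub>R (x - u)) + k i" .
    qed
    moreover have "x = t *\<^sub>R ((1 / t) *\<^sub>R (x - u)) + u" using \<open>t > 0\<close> by simp
    ultimately show ?thesis unfolding homothet_def by blast
  qed
qed

text \<open>Here the triangular shape enters: by \<open>l_solve\<close> a translation realizes every
  change of the three bounds that keeps their sum, so the sum alone determines the scale.\<close>

lemma halfplanes_homothet:
  assumes "0 \<le> t" "(\<Sum>i<3. c i) = - t"
  shows "\<exists>u. \<forall>x. x \<in> homothet t u P \<longleftrightarrow> (\<forall>i<3. c i \<le> l i x)"
proof -
  have "(\<Sum>i<3. c i + t * k i) = 0"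
    using assms sum_k by (simp add: sum.distrib flip: sum_distrib_left)
  then obtain u where "\<forall>i<3. l i u = c i + t * k i" using l_solve by blast
  then show ?thesis using mem_homothet[OF assms(1)] by (intro exI[of _ u]) simp
qed

definition m :: "nat \<Rightarrow> lattice_fun \<Rightarrow> real" where
  "m i = mn (\<lambda>a. l i (int_vec a))"

text \<open>The least scale of a copy containing the support (\<open>scale_size_eq\<close>), in a
  form whose additivity under convolution is visible.\<close>

definition size_of :: "lattice_fun \<Rightarrow> real" where
  "size_of f = - (\<Sum>i<3. m i f)"

lemma additive_l: "lattice_additive (\<lambda>a. l i (int_vec a))"
  using l_linear by (simp add: lattice_additive_def int_vec_add linear_add del: split_paired_All)

lemma m_mult: "f \<noteq> 0 \<Longrightarrow> g \<noteq> 0 \<Longrightarrow> m i (f * g) = m i f + m i g"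
  unfolding m_def by (rule mn_mult[OF additive_l])

lemma m_power: "f \<noteq> 0 \<Longrightarrow> m i (f ^ n) = real n * m i f"
  unfolding m_def by (rule mn_power[OF additive_l])

lemma m_le: "a \<in> supp f \<Longrightarrow> m i f \<le> l i (int_vec a)"
  unfolding m_def using mn_le[of a f "\<lambda>a. l i (int_vec a)"] by simp

lemma m_ge_iff: "f \<noteq> 0 \<Longrightarrow> c \<le> m i f \<longleftrightarrow> (\<forall>a\<in>supp f. c \<le> l i (int_vec a))"
  unfolding m_def by (rule mn_ge_iff)

lemma size_of_mult: "f \<noteq> 0 \<Longrightarrow> g \<noteq> 0 \<Longrightarrow> size_of (f * g) = size_of f + size_of g"
  by (simp add: size_of_def m_mult sum.distrib)

lemma size_of_power: "f \<noteq> 0 \<Longrightarrow> size_of (f ^ n) = real n * size_of f"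
  by (simp add: size_of_def m_power sum_distrib_left)

lemma nonzero_supp: "f \<noteq> 0 \<Longrightarrow> \<exists>a. a \<in> supp f"
  by (metis all_not_in_conv keys_eq_empty)

lemma size_of_nonneg:
  assumes "f \<noteq> 0"
  shows "0 \<le> size_of f"
proof -
  obtain a where "a \<in> supp f" using assms nonzero_supp by blast
  then have "(\<Sum>i<3. m i f) \<le> (\<Sum>i<3. l i (int_vec a))" by (intro sum_mono m_le)
  then show ?thesis by (simp add: size_of_def sum_l)
qed

lemma supp_homothet_size:
  assumes "f \<noteq> 0"
  obtains u where "int_vec ` supp f \<subseteq> homothet (size_of f) u P"
proof -
  have "\<exists>u. \<forall>x. x \<in> homothet (size_of f) u P \<longleftrightarrow> (\<forall>i<3. m i f \<le> l i x)"
    by (rule halfplanes_homothet[OF size_of_nonneg[OF assms]]) (simp add: size_of_def)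
  then show thesis using that m_le by blast
qed

lemma size_of_le:
  assumes "f \<noteq> 0" "0 \<le> t" "int_vec ` supp f \<subseteq> homothet t u P"
  shows "size_of f \<le> t"
proof -
  have "l i u - t * k i \<le> m i f" if "i < 3" for i
    unfolding m_ge_iff[OF assms(1)]
  proof
    fix a assume "a \<in> supp f"
    then have "int_vec a \<in> homothet t u P" using assms(3) by blast
    then show "l i u - t * k i \<le> l i (int_vec a)" using that by (simp add: mem_homothet assms(2))
  qed
  then have "(\<Sum>i<3. l i u - t * k i) \<le> (\<Sum>i<3. m i f)" by (intro sum_mono) simp
  then show ?thesis using sum_k by (simp add: size_of_def sum_subtractf sum_l flip: sum_distrib_left)
qed

lemma scale_size_eq:
  assumes "f \<noteq> 0"
  shows "scale_size P f = size_of f"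
  unfolding scale_size_def homothet_def[symmetric]
proof (rule Least_equality)
  show "0 \<le> size_of f \<and> (\<exists>u. int_vec ` supp f \<subseteq> homothet (size_of f) u P)"
    using size_of_nonneg supp_homothet_size assms by metis
next
  fix t assume "0 \<le> t \<and> (\<exists>u. int_vec ` supp f \<subseteq> homothet t u P)"
  then obtain u where "0 \<le> t" "int_vec ` supp f \<subseteq> homothet t u P" by blast
  then show "size_of f \<le> t" by (rule size_of_le[OF assms])
qed

text \<open>A non-unit has two distinct lattice points in its support, and these are at distance at least 1.\<close>

lemma size_of_lower_bound:
  obtains d where "0 < d" "\<And>f. f \<noteq> 0 \<Longrightarrow> \<not> f dvd 1 \<Longrightarrow> d \<le> size_of f"
proof -
  have "bounded P" using compact_P by (rule compact_imp_bounded)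
  then obtain B0 where B0: "\<And>x. x \<in> P \<Longrightarrow> norm x \<le> B0" unfolding bounded_iff by metis
  define B where "B = \<bar>B0\<bar> + 1"
  have B1: "0 < B" by (simp add: B_def)
  have B: "norm x \<le> B" if "x \<in> P" for x using B0[OF that] by (simp add: B_def)
  have "1 / (2 * B) \<le> size_of f" if f: "f \<noteq> 0" "\<not> f dvd 1" for f
  proof -
    obtain a where a: "a \<in> supp f" using f(1) nonzero_supp by blast
    have "supp f \<noteq> {a}"
    proof
      assume "supp f = {a}"
      then have "f = sgl a (cf f a)" using sum_single_cf[of f] by simp
      moreover have "cf f a \<noteq> 0" using a by (simp add: in_keys_iff)
      ultimately show False using sgl_unit f(2) by metis
    qed
    then obtain b where b: "b \<in> supp f" "b \<noteq> a" using a by blast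
    obtain u where "int_vec ` supp f \<subseteq> homothet (size_of f) u P" by (rule supp_homothet_size[OF f(1)])
    then obtain x y where "x \<in> P" "int_vec a = size_of f *\<^sub>R x + u" "y \<in> P" "int_vec b = size_of f *\<^sub>R y + u"
      using a b unfolding homothet_def by blast
    then have eq: "int_vec a - int_vec b = size_of f *\<^sub>R (x - y)" by (simp add: algebra_simps)
    have "1 \<le> norm (int_vec a - int_vec b)"
    proof -
      have "fst a \<noteq> fst b \<or> snd a \<noteq> snd b" using b(2) by (auto simp: prod_eq_iff)
      moreover have "\<bar>real_of_int (fst a - fst b)\<bar> \<le> norm (int_vec a - int_vec b)"
        "\<bar>real_of_int (snd a - snd b)\<bar> \<le> norm (int_vec a - int_vec b)"
        using norm_fst_le[of "real_of_int (fst a - fst b)" "real_of_int (snd a - snd b)"]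
         norm_snd_le[of "real_of_int (snd a - snd b)" "real_of_int (fst a - fst b)"] by (simp_all add: int_vec_def)
      moreover have "1 \<le> \<bar>real_of_int n\<bar>" if "n \<noteq> 0" for n using that by linarith
      ultimately show ?thesis by (smt (verit) eq_iff_diff_eq_0)
    qed
    also have "\<dots> = size_of f * norm (x - y)" using size_of_nonneg[OF f(1)] by (simp add: eq)
    also have "\<dots> \<le> size_of f * (2 * B)"
    proof (rule mult_left_mono[OF _ size_of_nonneg[OF f(1)]])
      show "norm (x - y) \<le> 2 * B"
        using norm_triangle_ineq4[of x y] B[OF \<open>x \<in> P\<close>] B[OF \<open>y \<in> P\<close>] by linarith
    qed
    finally show ?thesis using B1 by (simp add: field_simps)
  qed
  then show thesis using that[of "1 / (2 * B)"] B1 by simp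
qed

end

subsection \<open>An intersection inequality\<close>

text \<open>Indexes the monomials of degree below \<open>n\<close>, and also the linear conditions
  for vanishing to order \<open>n\<close> at \<open>(1, 1)\<close>.\<close>

definition tri :: "nat \<Rightarrow> (nat \<times> nat) set" where
  "tri n = {e. fst e + snd e < n}"

lemma finite_tri [simp]: "finite (tri n)"
  by (rule finite_subset[of _ "{..n} \<times> {..n}"]) (auto simp: tri_def)

lemma card_tri: "2 * card (tri n) = n * (n + 1)"
proof (induction n)
  case (Suc n)
  have eq: "tri (Suc n) = tri n \<union> (\<lambda>i. (i, n - i)) ` {..n}"
    by (auto simp: tri_def image_iff)
  have "card (tri (Suc n)) = card (tri n) + card ((\<lambda>i. (i, n - i)) ` {..n})"
    unfolding eq by (rule card_Un_disjoint[OF finite_tri]) (auto simp: tri_def)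
  also have "card ((\<lambda>i. (i, n - i)) ` {..n}) = Suc n"
    by (subst card_image) (auto simp: inj_on_def)
  finally show ?case using Suc by simp
qed (simp add: tri_def)

lemma power_sum_roots:
  fixes c :: "nat \<Rightarrow> real"
  assumes "\<And>j. j < K \<Longrightarrow> (\<Sum>i<K. c i * (w + real j) ^ i) = 0" "i < K"
  shows "c i = 0"
proof (rule ccontr)
  assume "c i \<noteq> 0"
  obtain n where n: "K = Suc n" using assms(2) by (cases K) auto
  have "c i \<noteq> 0" "i \<le> n" using \<open>c i \<noteq> 0\<close> assms(2) n by auto
  then have "finite {z. (\<Sum>i\<le>n. c i * z ^ i) = 0} \<and> card {z. (\<Sum>i\<le>n. c i * z ^ i) = 0} \<le> n"
    using polyfun_rootbound by blast
  moreover have "(\<lambda>j. w + real j) ` {..<K} \<subseteq> {z. (\<Sum>i\<le>n. c i * z ^ i) = 0}"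
    using assms(1) by (auto simp: n lessThan_Suc_atMost)
  moreover have "card ((\<lambda>j. w + real j) ` {..<K}) = K"
    by (subst card_image) (auto simp: inj_on_def)
  ultimately have "K \<le> n" by (metis card_mono le_trans)
  then show False using n by simp
qed

text \<open>The degree in each variable is below \<open>K\<close>, so counting roots in one variable
  and then in the other removes all coefficients.\<close>

lemma grid_vanishing:
  assumes "\<And>i j. i < K \<Longrightarrow> j < K \<Longrightarrow>
    (\<Sum>e\<in>tri K. p e * monomial_at e (int_vec (z + (int i, int j)))) = 0"
    and "e \<in> tri K"
  shows "p e = 0"
proof -
  define p' where "p' e = (if e \<in> tri K then p e else 0)" for e
  have sum: "(\<Sum>i'<K. (\<Sum>j'<K. p' (i', j') * (real_of_int (snd z) + real j) ^ j') * (real_of_int (fst z) + real i) ^ i') = 0"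
    if "i < K" "j < K" for i j
  proof -
    have "(\<Sum>i'<K. (\<Sum>j'<K. p' (i', j') * (real_of_int (snd z) + real j) ^ j') * (real_of_int (fst z) + real i) ^ i')
       = (\<Sum>e\<in>{..<K}\<times>{..<K}. p' e * monomial_at e (int_vec (z + (int i, int j))))"
      unfolding sum_distrib_right sum.cartesian_product
      by (rule sum.cong) (auto simp: monomial_at_def int_vec_def)
    also have "\<dots> = (\<Sum>e\<in>tri K. p e * monomial_at e (int_vec (z + (int i, int j))))"
      by (rule sum.mono_neutral_cong_right) (auto simp: tri_def p'_def)
    finally show ?thesis using assms(1) that by simp
  qed
  have "(\<Sum>j'<K. p' (i', j') * (real_of_int (snd z) + real j) ^ j') = 0" if "i' < K" "j < K" for i' j
    by (rule power_sum_roots[of K "\<lambda>i'. \<Sum>j'<K. p' (i', j') * (real_of_int (snd z) + real j) ^ j'"])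
      (use sum that in auto)
  then have "p' (i', j') = 0" if "i' < K" "j' < K" for i' j'
    by (rule power_sum_roots[of K "\<lambda>j'. p' (i', j')"]) (use that in auto)
  then have "p' e = 0" using assms(2) by (cases e) (auto simp: tri_def)
  then show ?thesis using assms(2) by (simp add: p'_def)
qed

text \<open>Matrix of the map from the moments of \<open>x\<close> to those of \<open>F * x\<close>,
  read off from the Leibniz rule. Entries with \<open>e'\<close> not below \<open>e\<close> vanish
  through the binomial coefficients.\<close>

definition shift_coeff :: "lattice_fun \<Rightarrow> nat \<times> nat \<Rightarrow> nat \<times> nat \<Rightarrow> real" where
  "shift_coeff F e e' = real (fst e choose fst e') * real (snd e choose snd e')
     * moment F (fst e - fst e', snd e - snd e')"

text \<open>A moment of \<open>x\<close> of degree at least \<open>\<nu>\<close> is multiplied by a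
  moment of \<open>F\<close> of degree below \<open>\<mu>\<close>, which vanishes. Hence
  orthogonality to all multiples of \<open>F\<close> can be imposed by
  \<open>card (tri \<nu>)\<close> equations.\<close>

lemma moment_mult_truncated:
  assumes F: "\<And>e. e \<in> tri \<mu> \<Longrightarrow> moment F e = 0" and e: "e \<in> tri (\<mu> + \<nu>)"
  shows "moment (F * x) e = (\<Sum>e'\<in>tri \<nu>. shift_coeff F e e' * moment x e')"
proof -
  obtain i j where ij: "e = (i, j)" by (cases e)
  let ?t = "\<lambda>e'. shift_coeff F e e' * moment x e'"
  have "moment (F * x) e = moment (x * F) e" by (simp add: mult.commute)
  also have "\<dots> = (\<Sum>e'\<in>{..i}\<times>{..j}. ?t e')"
    unfolding ij moment_mult
    by (simp add: sum.cartesian_product case_prod_beta shift_coeff_def mult_ac)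
  also have "\<dots> = (\<Sum>e'\<in>({..i}\<times>{..j}) \<inter> tri \<nu>. ?t e')"
  proof (rule sum.mono_neutral_right)
    show "\<forall>e'\<in>{..i}\<times>{..j} - {..i}\<times>{..j} \<inter> tri \<nu>. ?t e' = 0"
    proof
      fix e' assume "e' \<in> {..i}\<times>{..j} - {..i}\<times>{..j} \<inter> tri \<nu>"
      then have "(fst e - fst e', snd e - snd e') \<in> tri \<mu>"
        using e by (auto simp: tri_def ij)
      from F[OF this] show "?t e' = 0" by (simp add: shift_coeff_def)
    qed
  qed auto
  also have "\<dots> = (\<Sum>e'\<in>tri \<nu>. ?t e')"
    by (rule sum.mono_neutral_left) (auto simp: shift_coeff_def ij not_le)
  finally show ?thesis .
qed

lemma orthogonal_moments:
  assumes F: "\<And>e. e \<in> tri \<mu> \<Longrightarrow> moment F e = 0"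
    and p: "\<And>e'. e' \<in> tri \<nu> \<Longrightarrow> (\<Sum>e\<in>tri (\<mu> + \<nu>). shift_coeff F e e' * p e) = 0"
  shows "(\<Sum>e\<in>tri (\<mu> + \<nu>). p e * moment (F * x) e) = 0"
proof -
  have "(\<Sum>e\<in>tri (\<mu> + \<nu>). p e * moment (F * x) e) =
     (\<Sum>e\<in>tri (\<mu> + \<nu>). \<Sum>e'\<in>tri \<nu>. moment x e' * (shift_coeff F e e' * p e))"
    by (rule sum.cong) (simp_all add: moment_mult_truncated[OF F] sum_distrib_left mult_ac)
  also have "\<dots> = (\<Sum>e'\<in>tri \<nu>. moment x e' * (\<Sum>e\<in>tri (\<mu> + \<nu>). shift_coeff F e e' * p e))"
    by (subst sum.swap) (simp add: sum_distrib_left)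
  finally show ?thesis using p by simp
qed

lemma cf_mult_superset':
  fixes F x :: lattice_fun
  assumes "finite B" "supp x \<subseteq> B"
  shows "cf (F * x) a = (\<Sum>b\<in>B. cf F (a - b) * cf x b)"
  using cf_mult_superset[OF assms, of F a] by (simp add: mult.commute)

text \<open>One factor \<open>f\<close> is split off at a time: being prime, \<open>f\<close>
  divides no power of \<open>h\<close>, so it divides what remains of \<open>y\<close>.\<close>

lemma irreducible_power_dvd:
  fixes f h :: lattice_fun
  assumes f: "irreducible f" "\<not> f dvd h" and "f ^ n dvd h ^ k * y"
  shows "f ^ n dvd y"
  using assms(3)
proof (induction n)
  case (Suc n)
  have nd: "\<not> f dvd h ^ j" for j
    by (induction j) (use f irreducible_imp_prime_lattice irreducible_not_unit in auto)
  have "f ^ n dvd y" using Suc by (metis dvd_mult_right power_Suc)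
  then obtain z where z: "y = f ^ n * z" by (elim dvdE)
  from Suc.prems obtain s where "h ^ k * y = f ^ Suc n * s" by (elim dvdE)
  then have "f ^ n * (f * s) = f ^ n * (h ^ k * z)" by (simp add: z mult_ac)
  then have "f * s = h ^ k * z"
    using f(1) by (subst (asm) lattice_fun_mult_cancel) auto
  then have "f dvd h ^ k * z" by (metis dvd_triv_left)
  then have "f dvd z" using irreducible_imp_prime_lattice[OF f(1)] nd by blast
  then show ?case by (simp add: z mult.commute[of f] mult_dvd_mono)
qed simp

context triangle
begin

text \<open>A lattice triangle given by its bounds: multiplication by \<open>F\<close> shifts them
  by \<open>m i F\<close>, and no translation vector has to be tracked.\<close>

definition region :: "(nat \<Rightarrow> real) \<Rightarrow> (int \<times> int) set" where
  "region c = {a. \<forall>i<3. c i \<le> l i (int_vec a)}"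

lemma region_homothet:
  assumes "0 \<le> t" "(\<Sum>i<3. c i) = - t"
  shows "\<exists>u. region c = {a. int_vec a \<in> homothet t u P}"
proof -
  obtain u where "\<forall>x. x \<in> homothet t u P \<longleftrightarrow> (\<forall>i<3. c i \<le> l i x)"
    using halfplanes_homothet[OF assms] by blast
  then have "region c = {a. int_vec a \<in> homothet t u P}"
    unfolding region_def by (simp del: split_paired_All)
  then show ?thesis by blast
qed

lemma finite_region:
  assumes "(\<Sum>i<3. c i) \<le> 0"
  shows "finite (region c)"
proof -
  obtain u where "region c = {a. int_vec a \<in> homothet (- (\<Sum>i<3. c i)) u P}"
    using region_homothet[of "- (\<Sum>i<3. c i)" c] assms by auto
  then show ?thesis
    by (simp add: finite_lattice_points compact_imp_bounded compact_homothet compact_P)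
qed

lemma supp_mult_region:
  assumes "supp x \<subseteq> region (\<lambda>i. c i - m i F)"
  shows "supp (F * x) \<subseteq> region c"
proof
  fix e assume "e \<in> supp (F * x)"
  then obtain a b where ab: "a \<in> supp F" "b \<in> supp x" "e = a + b"
    using keys_mult[of F x] by blast
  show "e \<in> region c"
    unfolding region_def
  proof (intro CollectI allI impI)
    fix i :: nat assume "i < 3"
    then have "c i - m i F \<le> l i (int_vec b)" using ab(2) assms by (auto simp: region_def)
    then show "c i \<le> l i (int_vec e)"
      using m_le[OF ab(1), of i] l_linear[of i] by (simp add: ab(3) int_vec_add linear_add)
  qed
qed

lemma supp_quotient_region:
  assumes "F \<noteq> 0" "z \<noteq> 0" "supp (F * z) \<subseteq> region c"
  shows "supp z \<subseteq> region (\<lambda>i. c i - m i F)"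
proof -
  have "c i - m i F \<le> m i z" if "i < 3" for i
  proof -
    have "c i \<le> m i (F * z)"
      using assms that by (subst m_ge_iff) (auto simp: region_def)
    then show ?thesis using assms by (simp add: m_mult)
  qed
  then show ?thesis using m_le unfolding region_def by (force intro: order_trans)
qed

text \<open>
  The unknowns are functions \<open>x\<close>, \<open>y\<close> on two smaller triangles and a polynomial \<open>p\<close> of degree
  less than \<open>\<mu> + \<nu>\<close>, the equations say that \<open>F * x + G * y + p\<close> vanishes on the large triangle,
  that \<open>p\<close> is orthogonal to all multiples of \<open>F\<close> and \<open>G\<close>, and that \<open>y\<close> is not a
  nonzero multiple of \<open>F\<close>.  Only the trivial solution exists, so there are at least as many
  equations as unknowns.
\<close>

lemma intersection_count:
  fixes F G :: lattice_fun
  assumes FG: "F \<noteq> 0" "G \<noteq> 0"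
    and coprime: "\<And>x y. F * x = G * y \<Longrightarrow> F dvd y"
    and \<mu>: "\<And>e. e \<in> tri \<mu> \<Longrightarrow> moment F e = 0" and \<nu>: "\<And>e. e \<in> tri \<nu> \<Longrightarrow> moment G e = 0"
    and c: "size_of F + size_of G \<le> - (\<Sum>i<3. c i)"
    and grid: "\<And>i j. i < \<mu> + \<nu> \<Longrightarrow> j < \<mu> + \<nu> \<Longrightarrow> z0 + (int i, int j) \<in> region c"
  shows "card (region (\<lambda>i. c i - m i F)) + card (region (\<lambda>i. c i - m i G)) + \<mu> * \<nu>
    \<le> card (region c) + card (region (\<lambda>i. c i - m i G - m i F))"
proof (rule ccontr)
  define A where "A = region c"
  define B where "B = region (\<lambda>i. c i - m i F)"
  define C where "C = region (\<lambda>i. c i - m i G)"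
  define D where "D = region (\<lambda>i. c i - m i G - m i F)"
  define K where "K = \<mu> + \<nu>"
  assume "\<not> ?thesis"
  then have less: "card A + card D < card B + card C + \<mu> * \<nu>" by (simp add: A_def B_def C_def D_def)
  have fin: "finite A" "finite B" "finite C" "finite D"
    unfolding A_def B_def C_def D_def using c size_of_nonneg[OF FG(1)] size_of_nonneg[OF FG(2)]
    by (auto intro!: finite_region simp: sum_subtractf size_of_def)
  \<comment> \<open>Origin of the term \<open>\<mu> * \<nu>\<close>: the polynomial brings
    \<open>card (tri K)\<close> unknowns, and its orthogonality relations are
    \<open>card (tri \<nu>) + card (tri \<mu>)\<close> equations.\<close>
  have "2 * (card (tri \<mu>) + card (tri \<nu>) + \<mu> * \<nu>) = 2 * card (tri K)"
    unfolding distrib_left card_tri K_def by (simp add: algebra_simps)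
  then have tri: "card (tri \<mu>) + card (tri \<nu>) + \<mu> * \<nu> = card (tri K)" by simp
  \<comment> \<open>By \<open>cf_mult_low\<close>, a nonzero \<open>F * z\<close> has a nonzero
    coefficient at \<open>a0\<close> plus the least point of \<open>z\<close>. So making
    \<open>y\<close> vanish on \<open>a0 + D\<close> excludes nonzero multiples of \<open>F\<close>
    with quotient supported in \<open>D\<close>.\<close>
  define a0 where "a0 = low (\<lambda>_. 0) F"
  let ?I = "B <+> (C <+> tri K)"
  let ?J = "A <+> (D <+> (tri \<nu> <+> tri \<mu>))"
  define M where "M j i = (case j of
      Inl a \<Rightarrow> (case i of Inl b \<Rightarrow> cf F (a - b) | Inr (Inl b) \<Rightarrow> cf G (a - b) | Inr (Inr e) \<Rightarrow> monomial_at e (int_vec a))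
    | Inr (Inl d) \<Rightarrow> (case i of Inr (Inl b) \<Rightarrow> if b = a0 + d then 1 else 0 | _ \<Rightarrow> 0)
    | Inr (Inr (Inl e')) \<Rightarrow> (case i of Inr (Inr e) \<Rightarrow> shift_coeff F e e' | _ \<Rightarrow> 0)
    | Inr (Inr (Inr e')) \<Rightarrow> (case i of Inr (Inr e) \<Rightarrow> shift_coeff G e e' | _ \<Rightarrow> 0))"
    for j :: "(int \<times> int) + (int \<times> int) + (nat \<times> nat) + (nat \<times> nat)" and i :: "(int \<times> int) + (int \<times> int) + (nat \<times> nat)"
  have "card ?J < card ?I" using less tri fin by (simp add: card_Plus)
  from underdetermined_system[OF _ _ this, of M] fin obtain u where
    u: "\<exists>i\<in>?I. u i \<noteq> 0" and M: "\<And>j. j \<in> ?J \<Longrightarrow> (\<Sum>i\<in>?I. M j i * u i) = 0"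
    by auto
  have sumI: "(\<Sum>i\<in>?I. M j i * u i) = (\<Sum>b\<in>B. M j (Inl b) * u (Inl b)) +
     ((\<Sum>b\<in>C. M j (Inr (Inl b)) * u (Inr (Inl b))) + (\<Sum>e\<in>tri K. M j (Inr (Inr e)) * u (Inr (Inr e))))" for j
    using fin by (simp add: sum.Plus)
  define x where "x = (\<Sum>b\<in>B. sgl b (u (Inl b)))"
  define y where "y = (\<Sum>b\<in>C. sgl b (u (Inr (Inl b))))"
  define p where "p e = u (Inr (Inr e))" for e
  define q where "q a = (\<Sum>e\<in>tri K. p e * monomial_at e (int_vec a))" for a
  have cf_x: "cf x b = (if b \<in> B then u (Inl b) else 0)" for b
    unfolding x_def by (rule cf_sum_single[OF fin(2)])
  have cf_y: "cf y b = (if b \<in> C then u (Inr (Inl b)) else 0)" for b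
    unfolding y_def by (rule cf_sum_single[OF fin(3)])
  have supp_x: "supp x \<subseteq> B" and supp_y: "supp y \<subseteq> C"
    by (auto simp: in_keys_iff cf_x cf_y split: if_splits)
  define w where "w = F * x + G * y"
  have supp_w: "supp w \<subseteq> A"
    using supp_mult_region[OF supp_x[unfolded B_def]] supp_mult_region[OF supp_y[unfolded C_def]]
      keys_add[of "F * x" "G * y"] unfolding w_def A_def by blast
  have eq_A: "cf w a = - q a" if "a \<in> A" for a
    using M[OF InlI[OF that]] that unfolding sumI w_def
    by (simp add: M_def lookup_add cf_mult_superset'[OF fin(2) supp_x] cf_mult_superset'[OF fin(3) supp_y]
        cf_x cf_y q_def p_def mult.commute)
  have eq_D: "cf y (a0 + d) = 0" if "d \<in> D" for d
  proof -
    have "(\<Sum>b\<in>C. if b = a0 + d then u (Inr (Inl b)) else 0) =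
        (\<Sum>b\<in>C. (if b = a0 + d then 1 else 0) * u (Inr (Inl b)))" by (rule sum.cong) auto
    also have "\<dots> = 0"
      using M[OF InrI[OF InlI[OF that]]] unfolding sumI by (simp add: M_def)
    finally show ?thesis using fin by (simp add: cf_y)
  qed
  have eq_F: "(\<Sum>e\<in>tri (\<mu> + \<nu>). shift_coeff F e e' * p e) = 0" if "e' \<in> tri \<nu>" for e'
    using M[OF InrI[OF InrI[OF InlI[OF that]]]] unfolding sumI by (simp add: M_def p_def K_def)
  have eq_G: "(\<Sum>e\<in>tri (\<nu> + \<mu>). shift_coeff G e e' * p e) = 0" if "e' \<in> tri \<mu>" for e'
    using M[OF InrI[OF InrI[OF InrI[OF that]]]] unfolding sumI by (simp add: M_def p_def K_def add.commute)
  have "(\<Sum>e\<in>tri K. p e * moment (F * x) e) = 0"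
    unfolding K_def by (rule orthogonal_moments[OF \<mu> eq_F])
  moreover have "(\<Sum>e\<in>tri K. p e * moment (G * y) e) = 0"
    using orthogonal_moments[OF \<nu> eq_G, of y] unfolding K_def by (simp add: add.commute)
  ultimately have "(\<Sum>e\<in>tri K. p e * moment w e) = 0"
    by (simp add: w_def moment_pairing pairing_add distrib_left sum.distrib)
  also have "(\<Sum>e\<in>tri K. p e * moment w e) = (\<Sum>e\<in>tri K. \<Sum>a\<in>A. cf w a * (p e * monomial_at e (int_vec a)))"
    by (simp add: moment_pairing pairing_superset[OF fin(1) supp_w] sum_distrib_left mult_ac)
  also have "\<dots> = (\<Sum>a\<in>A. cf w a * q a)"
    by (subst sum.swap) (simp add: q_def sum_distrib_left)
  \<comment> \<open>On \<open>A\<close> the function \<open>w\<close> equals \<open>- q\<close>, and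
    it is orthogonal to \<open>p\<close>; over the reals the resulting sum of squares forces
    \<open>q\<close> to vanish.\<close>
  also have "\<dots> = - (\<Sum>a\<in>A. (q a)\<^sup>2)"
    by (simp add: eq_A power2_eq_square sum_negf cong: sum.cong)
  finally have q0: "\<forall>a\<in>A. q a = 0" using fin(1) by (simp add: sum_nonneg_eq_0_iff)
  have p0: "p e = 0" if "e \<in> tri K" for e
  proof (rule grid_vanishing[OF _ that, of p z0])
    fix i j assume "i < K" "j < K"
    then have "z0 + (int i, int j) \<in> A" using grid by (simp add: K_def A_def)
    then show "(\<Sum>e\<in>tri K. p e * monomial_at e (int_vec (z0 + (int i, int j)))) = 0"
      using q0 by (simp add: q_def)
  qed
  have "w = 0"
    using eq_A q0 supp_w by (intro poly_mapping_eqI) (metis in_keys_iff lookup_zero minus_zero subsetD)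
  then have "F * x = G * (- y)" by (simp add: w_def eq_neg_iff_add_eq_0)
  then have "F dvd y" using coprime[of x "- y"] by simp
  then obtain z where z: "y = F * z" by (elim dvdE)
  have "y = 0"
  proof (rule ccontr)
    assume "y \<noteq> 0"
    then have "z \<noteq> 0" using z by auto
    have "supp (F * z) \<subseteq> region (\<lambda>i. c i - m i G)" using supp_y unfolding z C_def .
    from supp_quotient_region[OF FG(1) \<open>z \<noteq> 0\<close> this]
    have "supp z \<subseteq> D" unfolding D_def .
    then have "low (\<lambda>_. 0) z \<in> D" using low(1)[OF \<open>z \<noteq> 0\<close>] by blast
    from eq_D[OF this] have "cf (F * z) (low (\<lambda>_. 0) F + low (\<lambda>_. 0) z) = 0" unfolding z a0_def .
    moreover have "lattice_additive (\<lambda>_. 0)" by (simp add: lattice_additive_def)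
    ultimately have "cf F (low (\<lambda>_. 0) F) * cf z (low (\<lambda>_. 0) z) = 0"
      using cf_mult_low[OF _ FG(1) \<open>z \<noteq> 0\<close>] by metis
    then show False
      using low(1)[OF FG(1), of "\<lambda>_. 0"] low(1)[OF \<open>z \<noteq> 0\<close>, of "\<lambda>_. 0"] by (simp add: in_keys_iff)
  qed
  moreover have "x = 0" using \<open>w = 0\<close> \<open>y = 0\<close> FG(1) by (simp add: w_def)
  ultimately have "u (Inl b) = 0" if "b \<in> B" for b using cf_x[of b] that by simp
  moreover have "u (Inr (Inl b)) = 0" if "b \<in> C" for b using cf_y[of b] \<open>y = 0\<close> that by simp
  ultimately have "u i = 0" if "i \<in> ?I" for i
    using that p0 by (auto simp: p_def)
  with u show False by blast
qed


section \<open>From the dimension count to the bound on orders of vanishing\<close>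

lemma homothet_contains_grid:
  assumes sq: "cbox (-1, -1) (1, 1) \<subseteq> homothet c y P" "0 < c" and t: "c * real K \<le> t"
  shows "\<exists>z. \<forall>i<K. \<forall>j<K. int_vec (z + (int i, int j)) \<in> homothet t u P"
proof (cases "K = 0")
  case False
  define s where "s = real K"
  have "s > 0" using False by (simp add: s_def)
  obtain w0 where "w0 \<in> P" using P_nonempty by blast
  define w where "w = (t - s * c) *\<^sub>R w0 + (u - s *\<^sub>R y)"
  have w: "w \<in> homothet (t - s * c) (u - s *\<^sub>R y) P" using \<open>w0 \<in> P\<close> by (auto simp: homothet_def w_def)
  obtain w1 w2 where w12: "w = (w1, w2)" by (cases w)
  have "int_vec ((\<lceil>w1\<rceil>, \<lceil>w2\<rceil>) + (int i, int j)) \<in> homothet t u P" if "i < K" "j < K" for i j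
  proof -
    define d where "d = int_vec ((\<lceil>w1\<rceil>, \<lceil>w2\<rceil>) + (int i, int j)) - w"
    \<comment> \<open>Rounding up moves a coordinate by less than 1 and the grid index is at most
      \<open>K - 1\<close>, so the coordinates of \<open>d\<close> stay within
      \<open>K\<close>.\<close>
    have "real i + 1 \<le> s" "real j + 1 \<le> s" using that by (auto simp: s_def)
    then have "\<bar>of_int \<lceil>w1\<rceil> + real i - w1\<bar> \<le> s" "\<bar>of_int \<lceil>w2\<rceil> + real j - w2\<bar> \<le> s" by linarith+
    then have "(1 / s) *\<^sub>R d \<in> cbox (-1, -1) (1, 1)"
      using \<open>s > 0\<close> by (simp add: d_def int_vec_def w12 mem_cbox_Pair abs_le_iff field_simps)
    with sq(1) obtain b where b: "b \<in> P" "(1 / s) *\<^sub>R d = c *\<^sub>R b + y" unfolding homothet_def by blast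
    have "d = s *\<^sub>R ((1 / s) *\<^sub>R d)" using \<open>s > 0\<close> by simp
    also have "\<dots> = (s * c) *\<^sub>R b + s *\<^sub>R y" by (simp add: b(2) scaleR_right_distrib)
    finally have "d \<in> homothet (s * c) (s *\<^sub>R y) P" using b(1) unfolding homothet_def by blast
    from homothet_add[OF convex_P _ _ w this] show ?thesis
      using \<open>s > 0\<close> sq(2) t by (simp add: d_def s_def mult.commute)
  qed
  then show ?thesis by blast
qed simp

lemma intersection_inequality:
  assumes f: "irreducible f" and h: "h \<noteq> 0" "\<not> f dvd h"
  shows "real (mult_at_one f) * real (mult_at_one h) \<le> 2 * measure lebesgue P * size_of f * size_of h"
proof -
  define \<mu> \<nu> where "\<mu> = mult_at_one f" and "\<nu> = mult_at_one h"
  define s t where "s = size_of f" and "t = size_of h"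
  define V where "V = measure lebesgue P"
  have f0: "f \<noteq> 0" using f by (auto simp: irreducible_def)
  have st: "0 \<le> s" "0 \<le> t" using size_of_nonneg f0 h(1) by (auto simp: s_def t_def)
  obtain c y where c: "0 < c" "cbox (-1, -1) (1, 1) \<subseteq> homothet c y P"
    using interior_homothet_square[OF P_interior] by blast
  \<comment> \<open>Large enough, uniformly in \<open>n\<close>, for the lower counts in the two
    middle copies, for a nonnegative scale of the smallest copy and for the grid required by
    \<open>intersection_count\<close>.\<close>
  define T where "T = s + t + c * (real \<mu> + real \<nu> + 1)"
  have T: "c \<le> T - s" "c \<le> T - t" "0 \<le> T - s - t" "c * (real \<mu> + real \<nu>) \<le> T" "s + t \<le> T"
    using c st by (auto simp: T_def algebra_simps)
  have bound: "real n * (real \<mu> * real \<nu> - 2 * V * s * t) \<le> 2 * c * V * (4 * T - 2 * s - 2 * t)"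
    if n: "n > 0" for n
  proof -
    define N where "N = real n"
    have N: "N \<ge> 1" using n by (simp add: N_def)
    define F G where "F = f ^ n" and "G = h ^ n"
    have FG: "F \<noteq> 0" "G \<noteq> 0" using f0 h(1) by (auto simp: F_def G_def)
    have sizes: "size_of F = N * s" "size_of G = N * t"
      using f0 h(1) by (auto simp: F_def G_def size_of_power N_def s_def t_def)
    have sumF: "(\<Sum>i<3. m i F) = - (N * s)" "(\<Sum>i<3. m i G) = - (N * t)"
      using sizes by (auto simp: size_of_def)
    define cc where "cc i = - (N * T) / 3" for i :: nat
    have cc: "(\<Sum>i<3. cc i) = - (N * T)" by (simp add: cc_def)
    let ?A = "region cc" and ?B = "region (\<lambda>i. cc i - m i F)" and ?C = "region (\<lambda>i. cc i - m i G)"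
      and ?D = "region (\<lambda>i. cc i - m i G - m i F)"
    have "\<exists>u. ?A = {a. int_vec a \<in> homothet (N * T) u P}"
      by (rule region_homothet) (use N T c cc st in \<open>auto intro!: mult_nonneg_nonneg\<close>)
    then obtain uA where A: "?A = {a. int_vec a \<in> homothet (N * T) uA P}" by blast
    have "\<exists>u. ?B = {a. int_vec a \<in> homothet (N * (T - s)) u P}"
      by (rule region_homothet) (use N T c cc st sumF in \<open>auto simp: sum_subtractf algebra_simps intro!: mult_left_mono\<close>)
    then obtain uB where B: "?B = {a. int_vec a \<in> homothet (N * (T - s)) uB P}" by blast
    have "\<exists>u. ?C = {a. int_vec a \<in> homothet (N * (T - t)) u P}"
      by (rule region_homothet) (use N T c cc st sumF in \<open>auto simp: sum_subtractf algebra_simps intro!: mult_left_mono\<close>)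
    then obtain uC where C: "?C = {a. int_vec a \<in> homothet (N * (T - t)) uC P}" by blast
    have "\<exists>u. ?D = {a. int_vec a \<in> homothet (N * (T - s - t)) u P}"
    proof (rule region_homothet)
      show "0 \<le> N * (T - s - t)" using N T by simp
    qed (simp add: sum_subtractf cc sumF right_diff_distrib)
    then obtain uD where D: "?D = {a. int_vec a \<in> homothet (N * (T - s - t)) uD P}" by blast
    have "c * real (n * \<mu> + n * \<nu>) = N * (c * (real \<mu> + real \<nu>))" by (simp add: N_def algebra_simps)
    also have "\<dots> \<le> N * T" using T N by (intro mult_left_mono) auto
    finally obtain z0 where z0: "\<forall>i<n * \<mu> + n * \<nu>. \<forall>j<n * \<mu> + n * \<nu>.
        int_vec (z0 + (int i, int j)) \<in> homothet (N * T) uA P"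
      using homothet_contains_grid[OF c(2,1)] by blast
    have count: "card ?B + card ?C + (n * \<mu>) * (n * \<nu>) \<le> card ?A + card ?D"
    proof (rule intersection_count[OF FG])
      show "F dvd y" if "F * x = G * y" for x y
        using irreducible_power_dvd[OF f h(2), of n n y] that unfolding F_def G_def
        by (metis dvd_triv_left)
      show "moment F e = 0" if "e \<in> tri (n * \<mu>)" for e
        using that FG(1) f0 by (intro moment_below_mult) (auto simp: tri_def F_def sm_power \<mu>_def algebra_simps)
      show "moment G e = 0" if "e \<in> tri (n * \<nu>)" for e
        using that FG(2) h(1) by (intro moment_below_mult) (auto simp: tri_def G_def sm_power \<nu>_def algebra_simps)
      show "size_of F + size_of G \<le> - (\<Sum>i<3. cc i)"
        using T(5) N by (simp add: sizes cc flip: distrib_left)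
      show "z0 + (int i, int j) \<in> region cc" if "i < n * \<mu> + n * \<nu>" "j < n * \<mu> + n * \<nu>" for i j
        using z0 that by (simp add: A)
    qed
    have c0: "0 \<le> c" using c by simp
    have ge: "c \<le> N * (T - s)" "c \<le> N * (T - t)"
      using mult_mono[of 1 N c "T - s"] mult_mono[of 1 N c "T - t"] N T c0 by auto
    have le: "0 \<le> N * T" "0 \<le> N * (T - s - t)" using N T st by auto
    have "(N * (T - s) - c)\<^sup>2 * V + (N * (T - t) - c)\<^sup>2 * V + (N * \<mu>) * (N * \<nu>)
       \<le> real (card ?B) + real (card ?C) + real ((n * \<mu>) * (n * \<nu>))"
      unfolding B C V_def of_nat_mult N_def[symmetric]
      using card_lattice_lower[OF convex_P compact_P c(2) c0 ge(1), of uB]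
        card_lattice_lower[OF convex_P compact_P c(2) c0 ge(2), of uC] by linarith
    also have "\<dots> \<le> real (card ?A) + real (card ?D)"
      using of_nat_mono[OF count, where 'a = real] by simp
    also have "\<dots> \<le> (N * T + c)\<^sup>2 * V + (N * (T - s - t) + c)\<^sup>2 * V"
      unfolding A D V_def
      using card_lattice_upper[OF convex_P compact_P c(2) c0 le(1), of uA]
        card_lattice_upper[OF convex_P compact_P c(2) c0 le(2), of uD] by linarith
    \<comment> \<open>Here \<open>T\<^sup>2 + (T - s - t)\<^sup>2 - (T - s)\<^sup>2 - (T -
      t)\<^sup>2 = 2 * s * t\<close>, and the terms in \<open>c\<^sup>2\<close> cancel. The main
      term keeps one factor \<open>N\<close> more than the error.\<close>
    finally have "N * (N * (real \<mu> * real \<nu> - 2 * V * s * t)) \<le> N * (2 * c * V * (4 * T - 2 * s - 2 * t))"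
      by (simp add: power2_eq_square algebra_simps)
    then show ?thesis using N by (simp add: N_def)
  qed
  have "real \<mu> * real \<nu> - 2 * V * s * t \<le> 0"
  proof (rule ccontr)
    assume "\<not> ?thesis"
    then have pos: "0 < real \<mu> * real \<nu> - 2 * V * s * t" by simp
    then obtain n where n: "2 * c * V * (4 * T - 2 * s - 2 * t) < real n * (real \<mu> * real \<nu> - 2 * V * s * t)"
      using reals_Archimedean3 by blast
    with bound[of "Suc n"] pos show False by (simp add: algebra_simps)
  qed
  then show ?thesis by (simp add: \<mu>_def \<nu>_def s_def t_def V_def)
qed

end

subsection \<open>Areas of the convex hulls\<close>

lemma in_hull4:
  fixes p0 p1 p2 p3 :: "real \<times> real"
  assumes "0 \<le> u1" "0 \<le> u2" "0 \<le> u3" "u1 + u2 + u3 \<le> 1"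
  shows "(1 - u1 - u2 - u3) *\<^sub>R p0 + u1 *\<^sub>R p1 + u2 *\<^sub>R p2 + u3 *\<^sub>R p3 \<in> convex hull {p0, p1, p2, p3}"
proof -
  let ?u = "\<lambda>i::nat. if i = 0 then 1 - u1 - u2 - u3 else if i = 1 then u1 else if i = 2 then u2 else u3"
  let ?p = "\<lambda>i::nat. if i = 0 then p0 else if i = 1 then p1 else if i = 2 then p2 else p3"
  have "(\<Sum>i<4. ?u i *\<^sub>R ?p i) \<in> convex hull {p0, p1, p2, p3}"
  proof (rule convex_sum)
    show "(\<Sum>i<4. ?u i) = 1" by (simp add: eval_nat_numeral)
    show "?p i \<in> convex hull {p0, p1, p2, p3}" if "i \<in> {..<4}" for i by (simp add: hull_inc)
  qed (use assms in auto)
  then show ?thesis by (simp add: eval_nat_numeral)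
qed

text \<open>Case b) is the instance \<open>kite v v 0\<close>, in which the third vertex coincides
  with the second.\<close>

definition kite :: "real \<Rightarrow> real \<Rightarrow> real \<Rightarrow> (real \<times> real) set" where
  "kite v e1 e2 = convex hull {(0, 0), (v, 0), (e1, e2), (0, v)}"

lemma in_kite:
  assumes "0 \<le> u1" "0 \<le> u2" "0 \<le> u3" "u1 + u2 + u3 \<le> 1"
  shows "(u1 * v + u2 * e1, u2 * e2 + u3 * v) \<in> kite v e1 e2"
  using in_hull4[OF assms, of "(0, 0)" "(v, 0)" "(e1, e2)" "(0, v)"] by (simp add: kite_def)

lemma kiteE:
  assumes "x \<in> kite v e1 e2"
  obtains u1 u2 u3 where "0 \<le> u1" "0 \<le> u2" "0 \<le> u3" "u1 + u2 + u3 \<le> 1"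
    "x = (u1 * v + u2 * e1, u2 * e2 + u3 * v)"
proof -
  let ?S = "{(u1 * v + u2 * e1, u2 * e2 + u3 * v) | u1 u2 u3. 0 \<le> u1 \<and> 0 \<le> u2 \<and> 0 \<le> u3 \<and> u1 + u2 + u3 \<le> (1::real)}"
  have "convex ?S"
  proof (rule convexI)
    fix x y and s t :: real assume st: "0 \<le> s" "0 \<le> t" "s + t = 1" and "x \<in> ?S" "y \<in> ?S"
    then obtain a1 a2 a3 b1 b2 b3 where
      a: "0 \<le> a1" "0 \<le> a2" "0 \<le> a3" "a1 + a2 + a3 \<le> 1" "x = (a1 * v + a2 * e1, a2 * e2 + a3 * v)" and
      b: "0 \<le> b1" "0 \<le> b2" "0 \<le> b3" "b1 + b2 + b3 \<le> 1" "y = (b1 * v + b2 * e1, b2 * e2 + b3 * v)"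
      by blast
    have "s * (a1 + a2 + a3) + t * (b1 + b2 + b3) \<le> s * 1 + t * 1"
      using st a b by (intro add_mono mult_left_mono) auto
    then have "(s * a1 + t * b1) + (s * a2 + t * b2) + (s * a3 + t * b3) \<le> 1"
      using st by (simp add: algebra_simps)
    moreover have "s *\<^sub>R x + t *\<^sub>R y = ((s * a1 + t * b1) * v + (s * a2 + t * b2) * e1,
       (s * a2 + t * b2) * e2 + (s * a3 + t * b3) * v)"
      by (simp add: a b algebra_simps)
    moreover have "0 \<le> s * a1 + t * b1" "0 \<le> s * a2 + t * b2" "0 \<le> s * a3 + t * b3"
      using st a b by auto
    ultimately show "s *\<^sub>R x + t *\<^sub>R y \<in> ?S" by blast
  qed
  moreover have "{(0, 0), (v, 0), (e1, e2), (0, v)} \<subseteq> ?S"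
  proof -
    have "(0, 0) \<in> ?S" by (rule CollectI, rule exI[of _ 0], rule exI[of _ 0], rule exI[of _ 0]) simp
    moreover have "(v, 0) \<in> ?S" by (rule CollectI, rule exI[of _ 1], rule exI[of _ 0], rule exI[of _ 0]) simp
    moreover have "(e1, e2) \<in> ?S" by (rule CollectI, rule exI[of _ 0], rule exI[of _ 1], rule exI[of _ 0]) simp
    moreover have "(0, v) \<in> ?S" by (rule CollectI, rule exI[of _ 0], rule exI[of _ 0], rule exI[of _ 1]) simp
    ultimately show ?thesis by simp
  qed
  ultimately have "kite v e1 e2 \<subseteq> ?S" unfolding kite_def by (intro hull_minimal)
  with assms have "x \<in> ?S" by blast
  then show thesis using that by blast
qed

lemma compact_kite: "compact (kite v e1 e2)" and convex_kite: "convex (kite v e1 e2)"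
  unfolding kite_def by (simp_all add: compact_convex_hull finite_imp_compact)

lemma kite_interior:
  assumes "0 < v"
  shows "interior (kite v e1 e2) \<noteq> {}"
proof -
  have "box (0, 0) (v / 2, v / 2) \<subseteq> kite v e1 e2"
  proof
    fix x assume x: "x \<in> box (0, 0) (v / 2, v / 2)"
    obtain x1 x2 where x12: "x = (x1, x2)" by (cases x)
    have "(x1 / v * v + 0 * e1, 0 * e2 + x2 / v * v) \<in> kite v e1 e2"
      using x assms by (intro in_kite) (auto simp: x12 mem_box_Pair field_simps)
    then show "x \<in> kite v e1 e2" using assms by (simp add: x12)
  qed
  then have "box (0, 0) (v / 2, v / 2) \<subseteq> interior (kite v e1 e2)"
    by (rule interior_maximal) (rule open_box)
  moreover have "(v / 4, v / 4) \<in> box (0, 0) (v / 2, v / 2)" using assms by (simp add: mem_box_Pair)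
  ultimately show ?thesis by blast
qed

lemma triangle_integral:
  fixes b v :: real
  assumes "0 < b" "0 \<le> v"
  shows "(\<integral>\<^sup>+y. ennreal (v * (1 - y / b)) * indicator {0..b} y \<partial>lborel) = ennreal (v * b / 2)"
proof -
  have "(\<integral>\<^sup>+y. ennreal (v * (1 - y / b)) * indicator {0..b} y \<partial>lborel) =
     ennreal (v * (b - b\<^sup>2 / (2 * b)) - v * (0 - 0\<^sup>2 / (2 * b)))"
  proof (rule nn_integral_FTC_Icc[where F = "\<lambda>y. v * (y - y\<^sup>2 / (2 * b))"])
    show "((\<lambda>y. v * (y - y\<^sup>2 / (2 * b))) has_real_derivative v * (1 - y / b)) (at y)" for y
      using assms(1) by (auto intro!: derivative_eq_intros simp: field_simps)
    show "0 \<le> v * (1 - y / b)" if "y \<in> {0..b}" for y using that assms by simp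
  qed (use assms in auto)
  also have "v * (b - b\<^sup>2 / (2 * b)) - v * (0 - 0\<^sup>2 / (2 * b)) = v * b / 2"
    using assms by (simp add: power2_eq_square)
  finally show ?thesis .
qed

text \<open>Cavalieri: the bound on slices is the slice length of a triangle with base
  \<open>v\<close> and height \<open>b\<close>; the offset \<open>g y\<close> only shears
  it.\<close>

lemma lower_triangle_measure:
  assumes "A \<in> sets borel" "0 < b" "0 \<le> v"
    and slice: "\<And>x y. (x, y) \<in> A \<Longrightarrow> 0 \<le> y \<and> y \<le> b \<and> g y \<le> x \<and> x \<le> g y + v * (1 - y / b)"
  shows "emeasure lborel (A :: (real \<times> real) set) \<le> ennreal (v * b / 2)"
proof -
  have "emeasure lborel A = emeasure (lborel \<Otimes>\<^sub>M lborel) A" by (simp add: lborel_prod)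
  also have "\<dots> = (\<integral>\<^sup>+y. emeasure lborel ((\<lambda>x. (x, y)) -` A) \<partial>lborel)"
    by (rule lborel_pair.emeasure_pair_measure_alt2) (simp only: lborel_prod sets_lborel assms(1))
  also have "\<dots> \<le> (\<integral>\<^sup>+y. ennreal (v * (1 - y / b)) * indicator {0..b} y \<partial>lborel)"
  proof (rule nn_integral_mono)
    fix y :: real
    have "emeasure lborel ((\<lambda>x. (x, y)) -` A) \<le>
        emeasure lborel (if y \<in> {0..b} then {g y..g y + v * (1 - y / b)} else {})"
      by (rule emeasure_mono) (use slice in auto)
    also have "\<dots> = ennreal (v * (1 - y / b)) * indicator {0..b} y"
    proof (cases "y \<in> {0..b}")
      case True
      then have "0 \<le> v * (1 - y / b)" using assms by simp
      then show ?thesis using True by simp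
    qed auto
    finally show "emeasure lborel ((\<lambda>x. (x, y)) -` A) \<le> ennreal (v * (1 - y / b)) * indicator {0..b} y" .
  qed
  also have "\<dots> = ennreal (v * b / 2)" using assms by (intro triangle_integral)
  finally show ?thesis .
qed

lemma emeasure_lborel_swap:
  assumes "A \<in> sets borel"
  shows "emeasure lborel (prod.swap -` A) = emeasure lborel (A :: (real \<times> real) set)"
proof -
  have "emeasure lborel A = emeasure (distr (lborel \<Otimes>\<^sub>M lborel) (lborel \<Otimes>\<^sub>M lborel) (\<lambda>(x, y). (y, x))) A"
    unfolding lborel_pair.distr_pair_swap[symmetric] by (simp add: lborel_prod)
  also have "\<dots> = emeasure (lborel \<Otimes>\<^sub>M lborel) ((\<lambda>(x, y). (y, x)) -` A \<inter> space (lborel \<Otimes>\<^sub>M lborel))"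
    by (rule emeasure_distr[OF measurable_pair_swap']) (simp only: lborel_prod sets_lborel assms(1))
  also have "(\<lambda>(x, y). (y, x)) -` A \<inter> space (lborel \<Otimes>\<^sub>M lborel) = prod.swap -` A"
    by (auto simp: space_pair_measure)
  finally show ?thesis by (simp add: lborel_prod)
qed

lemma kite_swap: "x \<in> kite v e1 e2 \<Longrightarrow> prod.swap x \<in> kite v e2 e1"
proof (erule kiteE)
  fix u1 u2 u3 assume "0 \<le> u1" "0 \<le> u2" "0 \<le> u3" "u1 + u2 + u3 \<le> 1"
    "x = (u1 * v + u2 * e1, u2 * e2 + u3 * v)"
  then show "prod.swap x \<in> kite v e2 e1"
    using in_kite[of u3 u2 u1 v e2 e1] by (simp add: algebra_simps)
qed

text \<open>For \<open>v \<le> e1 + e2\<close> this is the triangle spanned by the origin,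
  \<open>(v, 0)\<close> and \<open>(e1, e2)\<close>, cut off by the diagonal. The other half is a
  mirror image with \<open>e1\<close> and \<open>e2\<close> exchanged.\<close>

definition half_kite :: "real \<Rightarrow> real \<Rightarrow> real \<Rightarrow> (real \<times> real) set" where
  "half_kite v e1 e2 = kite v e1 e2 \<inter> {x. snd x * e1 \<le> fst x * e2}"

lemma half_kite_borel: "half_kite v e1 e2 \<in> sets borel"
proof -
  have "closed {x :: real \<times> real. snd x * e1 \<le> fst x * e2}"
    by (intro closed_Collect_le continuous_intros)
  then show ?thesis
    unfolding half_kite_def by (rule borel_closed[OF closed_Int[OF compact_imp_closed[OF compact_kite]]])
qed

lemma half_kite_measure:
  assumes v: "0 < v" and e: "0 \<le> e1" "0 \<le> e2" "v \<le> e1 + e2"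
  shows "emeasure lborel (half_kite v e1 e2) \<le> ennreal (v * e2 / 2)"
proof (cases "e2 = 0")
  \<comment> \<open>The triangle degenerates to a part of the first axis; it is treated apart
    because the slices divide by \<open>e2\<close>.\<close>
  case True
  have "half_kite v e1 e2 \<subseteq> (\<lambda>x. (x, 0)) ` UNIV"
  proof
    fix x assume "x \<in> half_kite v e1 e2"
    then have "x \<in> kite v e1 e2" "snd x * e1 \<le> fst x * e2" by (auto simp: half_kite_def)
    then obtain u1 u2 u3 where u: "0 \<le> u3" "x = (u1 * v + u2 * e1, u3 * v)" "snd x * e1 \<le> 0"
      using True by (auto elim: kiteE)
    have "e1 > 0" using True e v by simp
    then have "v * e1 > 0" using v by simp
    moreover have "u3 * (v * e1) \<le> 0" using u by simp
    ultimately have "u3 = 0" using u(1) by (metis mult_pos_pos not_le order_le_less)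
    then have "snd x = 0" using u(2) by simp
    then show "x \<in> (\<lambda>x. (x, 0)) ` UNIV" by (cases x) auto
  qed
  then have "half_kite v e1 e2 \<subseteq> UNIV \<times> {0}" by auto
  then have "emeasure lborel (half_kite v e1 e2) \<le> emeasure lborel (UNIV \<times> {0} :: (real \<times> real) set)"
    by (rule emeasure_mono) (simp add: closed_Times)
  also have "\<dots> = emeasure (lborel \<Otimes>\<^sub>M lborel) (UNIV \<times> {0} :: (real \<times> real) set)" by (simp add: lborel_prod)
  also have "\<dots> = 0" by (subst lborel.emeasure_pair_measure_Times) auto
  finally show ?thesis by simp
next
  case False
  then have "e2 > 0" using e by simp
  show ?thesis
  proof (rule lower_triangle_measure[OF half_kite_borel \<open>e2 > 0\<close>, where v = v and g = "\<lambda>y. y * e1 / e2"])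
    fix x y assume xy: "(x, y) \<in> half_kite v e1 e2"
    then have le: "y * e1 \<le> x * e2" by (simp add: half_kite_def)
    from xy have "(x, y) \<in> kite v e1 e2" by (simp add: half_kite_def)
    then obtain u1 u2 u3 where u: "0 \<le> u1" "0 \<le> u2" "0 \<le> u3" "u1 + u2 + u3 \<le> 1"
      and x: "x = u1 * v + u2 * e1" and y: "y = u2 * e2 + u3 * v"
      by (auto elim: kiteE)
    have "v * (u3 * e1) \<le> v * (u1 * e2)" using le by (simp add: x y algebra_simps)
    then have le': "u3 * e1 \<le> u1 * e2" using v by simp
    \<comment> \<open>Position of \<open>(e1, e2)\<close> on or beyond the segment between
      \<open>(v, 0)\<close> and \<open>(0, v)\<close>, combined with \<open>le'\<close>: on this
      side of the diagonal the vertex \<open>(0, v)\<close> does not raise the height above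
      \<open>e2\<close>.\<close>
    have "u3 * v \<le> u3 * (e1 + e2)" using u e by (intro mult_left_mono)
    also have "\<dots> \<le> (u1 + u3) * e2" using le' by (simp add: algebra_simps)
    also have "\<dots> \<le> (1 - u2) * e2" using u e by (intro mult_right_mono) auto
    finally have "y \<le> e2" by (simp add: y algebra_simps)
    moreover have "0 \<le> y" using u e v by (simp add: y)
    moreover have "y * e1 / e2 \<le> x" using le \<open>e2 > 0\<close> by (simp add: field_simps)
    moreover have "x \<le> y * e1 / e2 + v * (1 - y / e2)"
    proof -
      have "v * (u1 * e2 + u3 * v) \<le> v * (e2 - u2 * e2 + u3 * e1)"
      proof (rule mult_left_mono)
        have "(u1 + u2 + u3) * e2 \<le> 1 * e2" using u e by (intro mult_right_mono) auto
        moreover have "u3 * v \<le> u3 * (e1 + e2)" using u e by (intro mult_left_mono)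
        ultimately show "u1 * e2 + u3 * v \<le> e2 - u2 * e2 + u3 * e1" by (simp add: algebra_simps)
      qed (use v in simp)
      then have "x * e2 \<le> y * e1 + v * (e2 - y)" by (simp add: x y algebra_simps)
      then show ?thesis using \<open>e2 > 0\<close> by (simp add: field_simps)
    qed
    ultimately show "0 \<le> y \<and> y \<le> e2 \<and> y * e1 / e2 \<le> x \<and> x \<le> y * e1 / e2 + v * (1 - y / e2)" by blast
  qed (use v in simp)
qed

lemma measure_kite_le:
  assumes v: "0 < v" and e: "0 \<le> e1" "0 \<le> e2" "v \<le> e1 + e2"
  shows "measure lebesgue (kite v e1 e2) \<le> v * (e1 + e2) / 2"
proof -
  have "kite v e1 e2 \<subseteq> half_kite v e1 e2 \<union> prod.swap -` half_kite v e2 e1"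
    using kite_swap by (auto simp: half_kite_def)
  moreover have "prod.swap -` half_kite v e2 e1 \<in> sets borel"
    using measurable_sets[OF borel_measurable_continuous_onI[of prod.swap] half_kite_borel]
    by (simp add: continuous_on_swap)
  ultimately have "emeasure lborel (kite v e1 e2) \<le>
      emeasure lborel (half_kite v e1 e2) + emeasure lborel (prod.swap -` half_kite v e2 e1)"
    using half_kite_borel[of v e1 e2]
    by (intro order_trans[OF emeasure_mono emeasure_subadditive]) auto
  also have "\<dots> \<le> ennreal (v * e2 / 2) + ennreal (v * e1 / 2)"
  proof (rule add_mono[OF half_kite_measure[OF v e]])
    show "emeasure lborel (prod.swap -` half_kite v e2 e1) \<le> ennreal (v * e1 / 2)"
      unfolding emeasure_lborel_swap[OF half_kite_borel] by (rule half_kite_measure) (use v e in auto)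
  qed
  also have "\<dots> = ennreal (v * (e1 + e2) / 2)"
    using v e by (subst ennreal_plus[symmetric]) (auto simp: field_simps)
  finally have "measure lborel (kite v e1 e2) \<le> v * (e1 + e2) / 2"
    using v e unfolding measure_def by (intro enn2real_leI) auto
  moreover have "measure lebesgue (kite v e1 e2) = measure lborel (kite v e1 e2)"
    by (rule measure_completion) (simp add: compact_imp_closed compact_kite)
  ultimately show ?thesis by simp
qed

subsection \<open>The limit set of a triangle\<close>

lemma dvd_1_mult_at_one:
  assumes "g dvd 1"
  shows "mult_at_one g = 0"
proof -
  obtain h where h: "1 = g * h" using assms by (elim dvdE)
  then have "g \<noteq> 0" "h \<noteq> 0" by auto
  then have "sm g + sm h = 0" using sm_mult[of g h] by (simp add: sm_1 flip: h)
  then show ?thesis by (cases "sm g", cases "sm h") (simp add: zero_prod_def)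
qed

context triangle
begin

definition level :: "nat \<Rightarrow> (int \<times> int) set" where
  "level n = {a. int_vec a \<in> homothet (2 ^ n) 0 P}"

lemma finite_level: "finite (level n)"
  unfolding level_def by (intro finite_lattice_points compact_imp_bounded compact_homothet compact_P)

lemma S_set_level: "S_set P = closure (\<Union>n. (\<lambda>e. (1 / 2 ^ n) *\<^sub>R nat_vec e) ` E_set (int_vec ` level n))"
proof -
  have "(\<lambda>x. 2 ^ n *\<^sub>R x) ` P \<inter> range int_vec = int_vec ` level n" for n
    unfolding level_def homothet_def add_0_right vimage_def[symmetric] image_vimage_eq by (rule refl)
  then show ?thesis unfolding S_set_def by simp
qed

lemma E_set_level:
  assumes "e \<in> E_set (int_vec ` level n)"
  obtains g where "g \<noteq> 0" "size_of g \<le> 2 ^ n" "sm g = e"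
proof -
  obtain g where g: "g \<noteq> 0" "supp g \<subseteq> level n" "sm g = e"
    by (rule E_set_imp_sm[OF finite_level assms])
  have "size_of g \<le> 2 ^ n"
    by (rule size_of_le[OF g(1), of _ 0]) (use g(2) in \<open>auto simp: level_def\<close>)
  then show thesis using that g by blast
qed

text \<open>
  A convex set of area at most that of the triangle cannot properly contain the limit set:
  the standard monomials are at least as numerous as the lattice points of the dilated triangle,
  and this is more than fits into the dilated convex set if a box is left out.
\<close>

lemma S_set_eqI:
  assumes H: "compact H" "convex H" "interior H \<noteq> {}"
    and area: "measure lebesgue H \<le> measure lebesgue P"
    and bound: "\<And>g t. g \<noteq> 0 \<Longrightarrow> size_of g \<le> t \<Longrightarrow> 0 < t \<Longrightarrow> (1 / t) *\<^sub>R nat_vec (sm g) \<in> H"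
  shows "S_set P = H"
proof
  define U where "U = (\<Union>n. (\<lambda>e. (1 / 2 ^ n) *\<^sub>R nat_vec e) ` E_set (int_vec ` level n))"
  have S: "S_set P = closure U" unfolding S_set_level U_def ..
  have E_H: "(1 / 2 ^ n) *\<^sub>R nat_vec e \<in> H" if "e \<in> E_set (int_vec ` level n)" for e n
    by (rule E_set_level[OF that]) (use bound[of _ "2 ^ n"] in auto)
  then have "U \<subseteq> H" unfolding U_def by blast
  then show "S_set P \<subseteq> H" unfolding S by (intro closure_minimal compact_imp_closed H)
  show "H \<subseteq> S_set P"
  proof (rule ccontr)
    assume "\<not> H \<subseteq> S_set P"
    then obtain x where x: "x \<in> H" "x \<notin> closure U" unfolding S by blast
    \<comment> \<open>A convex set with nonempty interior lies in the closure of its interior, so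
      one missing point yields a whole missing box.\<close>
    have "x \<in> closure (interior H)"
      using x(1) closure_subset[of H] by (subst convex_closure_interior[OF H(2,3)]) blast
    then have "- closure U \<inter> closure (interior H) \<noteq> {}" using x(2) by blast
    then have "- closure U \<inter> interior H \<noteq> {}"
      using open_Int_closure_eq_empty[of "- closure U" "interior H"] by auto
    then obtain z where "z \<in> - closure U \<inter> interior H" by blast
    moreover have "open (- closure U \<inter> interior H)" by auto
    ultimately obtain a b where ab: "z \<in> box a b" "cbox a b \<subseteq> - closure U \<inter> interior H"
      using open_contains_cbox[of "- closure U \<inter> interior H" z] by metis
    obtain a1 a2 b1 b2 where ab12: "a = (a1, a2)" "b = (b1, b2)" by (metis prod.exhaust)
    have pos: "0 < b1 - a1" "0 < b2 - a2"
      using ab(1) by (cases z; auto simp: ab12 mem_box_Pair)+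
    define d where "d = min (b1 - a1) (b2 - a2)"
    have d: "0 < d" using pos by (simp add: d_def)
    define V where "V = measure lebesgue P"
    obtain c y where c: "0 < c" "cbox (-1, -1) (1, 1) \<subseteq> homothet c y P"
      using interior_homothet_square[OF P_interior] by blast
    obtain c' y' where c': "0 < c'" "cbox (-1, -1) (1, 1) \<subseteq> homothet c' y' H"
      using interior_homothet_square[OF H(3)] by blast
    \<comment> \<open>The summand \<open>4 / d\<close> keeps the sides of the shrunken box at least
      \<open>N * d / 2\<close>, so its area has order \<open>N\<^sup>2\<close>; the last summand
      lets this area exceed the boundary error \<open>3 * V * (c + c') * N\<close>.\<close>
    obtain n where n: "c + c' + 4 / d + 12 * V * (c + c') / d\<^sup>2 < 2 ^ n"
      using real_arch_pow[of 2] by auto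
    define N :: real where "N = 2 ^ n"
    have "0 < 4 / d" "0 \<le> 12 * V * (c + c') / d\<^sup>2"
      using d c c' vol_P_pos by (auto simp: V_def intro!: divide_nonneg_nonneg mult_nonneg_nonneg)
    then have N: "c \<le> N" "c' \<le> N" "4 / d < N" "12 * V * (c + c') / d\<^sup>2 < N"
      using n c(1) c'(1) unfolding N_def by linarith+
    have N0: "0 < N" by (simp add: N_def)
    define E where "E = E_set (int_vec ` level n)"
    define \<iota> where "\<iota> = (\<lambda>e :: nat \<times> nat. (int (fst e), int (snd e)))"
    have \<iota>: "int_vec (\<iota> e) = nat_vec e" for e by (simp add: int_vec_def nat_vec_def \<iota>_def)
    have inj: "inj_on \<iota> E" by (rule inj_onI) (simp add: \<iota>_def prod_eq_iff)
    have E_hom: "int_vec (\<iota> e) \<in> homothet N 0 H" if "e \<in> E" for e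
    proof -
      have "(1 / N) *\<^sub>R nat_vec e \<in> H" using E_H that by (simp add: E_def N_def)
      moreover have "int_vec (\<iota> e) = N *\<^sub>R ((1 / N) *\<^sub>R nat_vec e) + 0" using N0 by (simp add: \<iota>)
      ultimately show ?thesis unfolding homothet_def by blast
    qed
    have "finite {a. int_vec a \<in> homothet N 0 H}"
      by (intro finite_lattice_points compact_imp_bounded compact_homothet H)
    then have fin_X: "finite (\<iota> ` E)" by (rule rev_finite_subset) (use E_hom in auto)
    then have fin_E: "finite E" using inj by (rule finite_imageD)
    have "(N - c)\<^sup>2 * V \<le> real (card (level n))"
      using card_lattice_lower[OF convex_P compact_P c(2) _ N(1), of 0] c(1)
      by (simp add: V_def level_def N_def)
    also have "\<dots> \<le> real (card E)"
      using card_le_card_E_set[OF finite_level, of n] fin_E by (simp add: E_def)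
    also have "\<dots> = real (card (\<iota> ` E))" using inj by (simp add: card_image)
    \<comment> \<open>The scaled missing box is shrunk by 1 on every side, so that a cell meeting it
      has its lower left corner in the unshrunken box, where no standard exponent can lie.\<close>
    also have "\<dots> \<le> measure lebesgue (homothet (N + c') y' H -
        cbox (N * a1 + 1, N * a2 + 1) (N * b1 - 1, N * b2 - 1))" (is "_ \<le> measure lebesgue (?H - ?Q)")
    proof (rule card_le_measure[OF fin_X])
      show "?H - ?Q \<in> lmeasurable"
        by (intro fmeasurable.Diff lmeasurable_compact compact_homothet H lmeasurable_cbox)
      fix w assume "w \<in> \<iota> ` E"
      then obtain e where e: "e \<in> E" "w = \<iota> e" by blast
      have "unit_cell w \<subseteq> ?H"
        using unit_cell_subset_homothet[OF H(2) c'(2) _ _ E_hom[OF e(1)]] c'(1) N0 by (simp add: e(2))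
      moreover have False if q: "q \<in> unit_cell w" "q \<in> ?Q" for q
      proof -
        obtain q1 q2 where q12: "q = (q1, q2)" by (cases q)
        have "N * a1 \<le> fst (int_vec w)" "fst (int_vec w) \<le> N * b1"
          "N * a2 \<le> snd (int_vec w)" "snd (int_vec w) \<le> N * b2"
          using q by (auto simp: q12 unit_cell_def int_vec_def mem_box_Pair mem_cbox_Pair)
        then have "(1 / N) *\<^sub>R int_vec w \<in> cbox a b"
          using N0 by (cases "int_vec w") (simp add: ab12 mem_cbox_Pair field_simps)
        then have "(1 / N) *\<^sub>R int_vec w \<notin> closure U" using ab(2) by blast
        moreover have "(1 / N) *\<^sub>R int_vec w \<in> U"
          using e unfolding U_def E_def N_def by (auto simp: \<iota>)
        ultimately show False using closure_subset[of U] by blast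
      qed
      ultimately show "unit_cell w \<subseteq> ?H - ?Q" by blast
    qed
    also have "\<dots> = measure lebesgue ?H - measure lebesgue ?Q"
    proof (rule measurable_measure_Diff)
      show "?H \<in> lmeasurable" by (intro lmeasurable_compact compact_homothet H)
      show "?Q \<subseteq> ?H"
      proof
        fix q assume q: "q \<in> ?Q"
        then have "(1 / N) *\<^sub>R q \<in> cbox a b"
          using N0 by (cases q) (simp add: ab12 mem_cbox_Pair field_simps)
        then have "(1 / N) *\<^sub>R q \<in> H" using ab(2) interior_subset by blast
        moreover have "q = N *\<^sub>R ((1 / N) *\<^sub>R q) + 0" using N0 by simp
        ultimately have "q \<in> homothet N 0 H" unfolding homothet_def by blast
        moreover have "0 \<in> homothet c' y' H"
          using c'(2) by (rule subsetD) (simp add: zero_prod_def mem_cbox_Pair)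
        ultimately have "q + 0 \<in> homothet (N + c') (0 + y') H"
          using N0 c'(1) by (intro homothet_add H) auto
        then show "q \<in> ?H" by simp
      qed
    qed auto
    also have "measure lebesgue ?H = (N + c')\<^sup>2 * measure lebesgue H"
      using N0 c'(1) by (simp add: measure_homothet)
    also have "\<dots> \<le> (N + c')\<^sup>2 * V" using area by (intro mult_left_mono) (auto simp: V_def)
    finally have "measure lebesgue ?Q \<le> V * ((N + c')\<^sup>2 - (N - c)\<^sup>2)"
      by (simp add: algebra_simps)
    also have "(N + c')\<^sup>2 - (N - c)\<^sup>2 = (c + c') * (2 * N + c' - c)"
      by (simp add: power2_eq_square algebra_simps)
    also have "V * ((c + c') * (2 * N + c' - c)) \<le> V * ((c + c') * (3 * N))"
      using c c' N vol_P_pos by (intro mult_left_mono) (auto simp: V_def)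
    finally have up: "measure lebesgue ?Q \<le> 3 * V * (c + c') * N" by (simp add: mult_ac)
    have "4 < N * d" using N(3) d by (simp add: field_simps)
    moreover have "N * d \<le> N * (b1 - a1)" "N * d \<le> N * (b2 - a2)" using N0 by (auto simp: d_def)
    ultimately have side: "N * d / 2 \<le> (N * b1 - 1) - (N * a1 + 1)" "N * d / 2 \<le> (N * b2 - 1) - (N * a2 + 1)"
      by (simp_all add: algebra_simps)
    have "0 < N * d" using N0 d by simp
    have "(N * d / 2) * (N * d / 2) \<le> ((N * b1 - 1) - (N * a1 + 1)) * ((N * b2 - 1) - (N * a2 + 1))"
      using side \<open>0 < N * d\<close> by (intro mult_mono) auto
    also have "\<dots> = measure lebesgue ?Q"
      using side \<open>0 < N * d\<close> by (simp add: content_Pair)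
    finally have "N * (N * d\<^sup>2) \<le> N * (12 * V * (c + c'))"
      using up by (simp add: power2_eq_square algebra_simps)
    then have "N * d\<^sup>2 \<le> 12 * V * (c + c')" using N0 by simp
    then show False using N(4) d by (simp add: field_simps)
  qed
qed

text \<open>The size of \<open>g\<close> pays \<open>n\<close> for the multiple \<open>n\<close> of
  \<open>(e1, e2)\<close> and \<open>r\<close> for a remainder of degree at most
  \<open>v * r\<close>. Division by \<open>t\<close> turns these shares into weights of the
  vertices.\<close>

lemma S_set_eq_kite:
  assumes v: "0 < v" and e: "0 \<le> e1" "0 \<le> e2" "v \<le> e1 + e2" and area: "v * (e1 + e2) \<le> 2 * measure lebesgue P"
    and bound: "\<And>g. g \<noteq> 0 \<Longrightarrow> \<exists>n h1 h2 r. 0 \<le> n \<and> 0 \<le> h1 \<and> 0 \<le> h2 \<and> h1 + h2 \<le> v * r \<and>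
       n + r \<le> size_of g \<and> nat_vec (sm g) = (n * e1 + h1, n * e2 + h2)"
  shows "S_set P = kite v e1 e2"
proof (rule S_set_eqI[OF compact_kite convex_kite kite_interior[OF v]])
  show "measure lebesgue (kite v e1 e2) \<le> measure lebesgue P"
    using measure_kite_le[OF v e] area by simp
  fix g :: lattice_fun and t :: real assume g: "g \<noteq> 0" "size_of g \<le> t" "0 < t"
  from bound[OF g(1)] obtain n h1 h2 r where b: "0 \<le> n" "0 \<le> h1" "0 \<le> h2" "h1 + h2 \<le> v * r"
    "n + r \<le> size_of g" "nat_vec (sm g) = (n * e1 + h1, n * e2 + h2)" by blast
  have "(h1 + h2) / v \<le> r" using b(4) v by (simp add: field_simps)
  then have "h1 / v + n + h2 / v \<le> t" using b(5) g(2) by (simp add: add_divide_distrib)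
  then have "(h1 / v + n + h2 / v) / t \<le> 1" using g(3) by simp
  then have "(h1 / v / t * v + n / t * e1, n / t * e2 + h2 / v / t * v) \<in> kite v e1 e2"
    using b v g(3) by (intro in_kite) (auto simp: add_divide_distrib)
  also have "(h1 / v / t * v + n / t * e1, n / t * e2 + h2 / v / t * v) = (1 / t) *\<^sub>R nat_vec (sm g)"
    using v by (simp add: b(6) add_divide_distrib)
  finally show "(1 / t) *\<^sub>R nat_vec (sm g) \<in> kite v e1 e2" .
qed

section \<open>Splitting off irreducible factors\<close>

lemma irreducible_size_pos:
  assumes "irreducible f"
  shows "0 < size_of f"
proof -
  obtain d where d: "0 < d" "\<And>f. f \<noteq> 0 \<Longrightarrow> \<not> f dvd 1 \<Longrightarrow> d \<le> size_of f"
    by (rule size_of_lower_bound) blast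
  have "f \<noteq> 0" "\<not> f dvd 1" using assms by (auto simp: irreducible_def)
  from d(2)[OF this] d(1) show ?thesis by linarith
qed

text \<open>Sizes are additive and \<open>f\<close> has positive size, which bounds the exponent of
  \<open>f\<close> in \<open>g\<close>.\<close>

lemma divide_out:
  fixes f g :: lattice_fun
  assumes f: "irreducible f" and g: "g \<noteq> 0"
  obtains n h where "g = f ^ n * h" "h \<noteq> 0" "\<not> f dvd h"
proof -
  have f0: "f \<noteq> 0" using f by (auto simp: irreducible_def)
  have le: "real n * size_of f \<le> size_of g" if "f ^ n dvd g" for n
  proof -
    obtain h where h: "g = f ^ n * h" using \<open>f ^ n dvd g\<close> by (elim dvdE)
    then show ?thesis using g f0 size_of_nonneg[of h] by (simp add: size_of_mult size_of_power)
  qed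
  obtain M :: nat where M: "size_of g < real M * size_of f"
    using reals_Archimedean3[OF irreducible_size_pos[OF f]] by blast
  have le_M: "n \<le> M" if "f ^ n dvd g" for n
  proof -
    have "real n * size_of f \<le> real M * size_of f" using le[OF that] M by simp
    then show ?thesis using irreducible_size_pos[OF f] by simp
  qed
  have fin: "finite {n. f ^ n dvd g}" by (rule finite_subset[of _ "{..M}"]) (use le_M in auto)
  define n where "n = Max {n. f ^ n dvd g}"
  have "{n. f ^ n dvd g} \<noteq> {}" by (auto intro: exI[of _ 0])
  with fin have "f ^ n dvd g" unfolding n_def using Max_in by blast
  then obtain h where h: "g = f ^ n * h" by (elim dvdE)
  moreover have "\<not> f dvd h"
  proof
    assume "f dvd h"
    then have "f ^ Suc n dvd g" unfolding h by (simp add: mult.commute[of f] mult_dvd_mono)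
    then have "Suc n \<le> n" using fin unfolding n_def by (intro Max_ge) auto
    then show False by simp
  qed
  ultimately show thesis using that g by auto
qed

text \<open>Both sides are additive under convolution. The induction measures size in units of
  \<open>d\<close>: a non-unit has size at least \<open>d\<close>, so each proper factor is smaller
  by at least one unit.\<close>

lemma mult_le_size_if_irreducibles:
  assumes irr: "\<And>f. irreducible f \<Longrightarrow> real (mult_at_one f) \<le> v * size_of f" and "0 \<le> v" and "g \<noteq> 0"
  shows "real (mult_at_one g) \<le> v * size_of g"
proof -
  obtain d where d: "0 < d" "\<And>f. f \<noteq> 0 \<Longrightarrow> \<not> f dvd 1 \<Longrightarrow> d \<le> size_of f"
    by (rule size_of_lower_bound) blast
  have "size_of g < real n * d \<Longrightarrow> g \<noteq> 0 \<Longrightarrow> real (mult_at_one g) \<le> v * size_of g" for n g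
  proof (induction n arbitrary: g)
    case 0
    then show ?case using size_of_nonneg[of g] by simp
  next
    case (Suc n)
    show ?case
    proof (cases "g dvd 1")
      case True
      then show ?thesis using dvd_1_mult_at_one[OF True] size_of_nonneg[OF Suc.prems(2)] assms(2) by simp
    next
      case nonunit: False
      show ?thesis
      proof (cases "irreducible g")
        case True
        then show ?thesis by (rule irr)
      next
        case False
        then obtain a b where ab: "g = a * b" "\<not> a dvd 1" "\<not> b dvd 1"
          using nonunit Suc.prems(2) unfolding irreducible_def by blast
        then have ab0: "a \<noteq> 0" "b \<noteq> 0" using Suc.prems(2) by auto
        have size: "size_of g = size_of a + size_of b" using ab0 by (simp add: ab(1) size_of_mult)
        have lt: "size_of a < real n * d" "size_of b < real n * d"
          using size Suc.prems(1) d(2)[OF ab0(1) ab(2)] d(2)[OF ab0(2) ab(3)] by (auto simp: algebra_simps)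
        have "real (mult_at_one g) = real (mult_at_one a) + real (mult_at_one b)"
          using ab0 by (simp add: ab(1) sm_mult)
        also have "\<dots> \<le> v * size_of a + v * size_of b"
          by (intro add_mono Suc.IH lt ab0)
        finally show ?thesis by (simp add: size distrib_left)
      qed
    qed
  qed
  moreover obtain n :: nat where "size_of g < real n * d" using reals_Archimedean3[OF d(1)] by blast
  ultimately show ?thesis using assms(3) by blast
qed

text \<open>For \<open>g = f ^ n * h\<close> the power of \<open>f\<close> yields the multiple of
  \<open>(e1, e2)\<close>. As \<open>v * w\<close> is twice the area of \<open>P\<close>, the
  intersection inequality bounds the degree of \<open>sm h\<close> by
  \<open>v * size_of h\<close>.\<close>

lemma S_set_of_irreducible:
  assumes f: "irreducible f" and e: "(e1, e2) = inverse (size_of f) *\<^sub>R nat_vec (sm f)"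
    and w: "w = e1 + e2" "sqrt (2 * measure lebesgue P) \<le> w" and v: "v = 2 * measure lebesgue P / w"
  shows "S_set P = kite v e1 e2"
proof (rule S_set_eq_kite)
  define s where "s = size_of f"
  have s: "0 < s" using irreducible_size_pos[OF f] by (simp add: s_def)
  have f0: "f \<noteq> 0" using f by (auto simp: irreducible_def)
  have e12: "e1 = real (fst (sm f)) / s" "e2 = real (snd (sm f)) / s"
    using e by (auto simp: nat_vec_def s_def divide_inverse mult.commute)
  show "0 \<le> e1" "0 \<le> e2" using s by (auto simp: e12)
  have "0 < sqrt (2 * measure lebesgue P)" using vol_P_pos by simp
  then have w0: "0 < w" using w(2) by linarith
  show v0: "0 < v" using w0 vol_P_pos by (simp add: v)
  have "2 * measure lebesgue P \<le> w * w"
    using real_le_lsqrt[of _ w] w(2) w0 real_sqrt_le_iff[of "2 * measure lebesgue P" "w * w"] by simp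
  then show "v \<le> e1 + e2" using w0 by (simp add: v field_simps flip: w(1))
  have vw: "v * w = 2 * measure lebesgue P" using w0 by (simp add: v)
  then show "v * (e1 + e2) \<le> 2 * measure lebesgue P" by (simp flip: w(1))
  fix g :: lattice_fun assume "g \<noteq> 0"
  from divide_out[OF f this] obtain n h where h: "g = f ^ n * h" "h \<noteq> 0" "\<not> f dvd h" .
  have "real (mult_at_one f) = w * s" using s by (simp add: w(1) e12 add_divide_distrib[symmetric])
  then have "w * s * real (mult_at_one h) \<le> v * w * s * size_of h"
    using intersection_inequality[OF f h(2,3)] by (simp add: vw s_def)
  then have "(w * s) * real (mult_at_one h) \<le> (w * s) * (v * size_of h)" by (simp add: mult_ac)
  then have "real (fst (sm h)) + real (snd (sm h)) \<le> v * size_of h" using w0 s by simp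
  moreover have "nat_vec (sm g) = (real n * s * e1 + real (fst (sm h)), real n * s * e2 + real (snd (sm h)))"
    using s f0 h by (simp add: nat_vec_def e12 sm_mult sm_power)
  moreover have "real n * s + size_of h \<le> size_of g"
    using f0 h by (simp add: size_of_mult size_of_power s_def)
  ultimately show "\<exists>n h1 h2 r. 0 \<le> n \<and> 0 \<le> h1 \<and> 0 \<le> h2 \<and> h1 + h2 \<le> v * r \<and>
       n + r \<le> size_of g \<and> nat_vec (sm g) = (n * e1 + h1, n * e2 + h2)"
    using s by (intro exI[of _ "real n * s"] exI[of _ "real (fst (sm h))"] exI[of _ "real (snd (sm h))"]
        exI[of _ "size_of h"]) simp
qed

text \<open>The bound passes from irreducibles to every \<open>g\<close>, so all of
  \<open>sm g\<close> may serve as the remainder, with multiple 0 of the third vertex.\<close>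

lemma S_set_without_irreducible:
  assumes irr: "\<And>f. irreducible f \<Longrightarrow> inverse (size_of f) * real (mult_at_one f) < sqrt (2 * measure lebesgue P)"
    and v: "v = sqrt (2 * measure lebesgue P)"
  shows "S_set P = kite v v 0"
proof (rule S_set_eq_kite)
  show v0: "0 < v" "0 \<le> v" "0 \<le> (0::real)" "v \<le> v + 0" using vol_P_pos by (auto simp: v)
  show "v * (v + 0) \<le> 2 * measure lebesgue P" using vol_P_pos by (simp add: v)
  fix g :: lattice_fun assume g: "g \<noteq> 0"
  have "real (mult_at_one f) \<le> v * size_of f" if "irreducible f" for f
    using irr[OF that] irreducible_size_pos[OF that] by (simp add: v field_simps)
  from mult_le_size_if_irreducibles[OF this v0(2) g]
  have "real (fst (sm g)) + real (snd (sm g)) \<le> v * size_of g" by simp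
  then show "\<exists>n h1 h2 r. 0 \<le> n \<and> 0 \<le> h1 \<and> 0 \<le> h2 \<and> h1 + h2 \<le> v * r \<and>
       n + r \<le> size_of g \<and> nat_vec (sm g) = (n * v + h1, n * 0 + h2)"
    by (intro exI[of _ 0] exI[of _ "real (fst (sm g))"] exI[of _ "real (snd (sm g))"]
        exI[of _ "size_of g"]) (simp add: nat_vec_def)
qed

end

theorem theorem22:
  fixes P :: "(real \<times> real) set" and p q r :: "real \<times> real"
  assumes "\<not> collinear {p, q, r}"
    and "P = convex hull {p, q, r}"
  shows "(\<forall>(f :: int \<times> int \<Rightarrow>\<^sub>0 real) (e1 :: real) (e2 :: real) (w :: real) (v :: real).
            irreducible f \<longrightarrow>
            (e1, e2) = inverse (scale_size P f) *\<^sub>R nat_vec (sm f) \<longrightarrow>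
            w = e1 + e2 \<longrightarrow>
            w \<ge> sqrt (2 * vol P) \<longrightarrow>
            v = 2 * vol P / w \<longrightarrow>
            S_set P = convex hull {(0, 0), (v, 0), (e1, e2), (0, v)})
       \<and> (\<not> (\<exists>f :: int \<times> int \<Rightarrow>\<^sub>0 real. irreducible f \<and>
               inverse (scale_size P f) * real (fst (sm f) + snd (sm f)) \<ge> sqrt (2 * vol P)) \<longrightarrow>
          (\<forall>v :: real. v = sqrt (2 * vol P) \<longrightarrow>
            S_set P = convex hull {(0, 0), (v, 0), (0, v)}))"
proof -
  from triangle_barycentric[OF assms] obtain l k where "triangle P l k" by blast
  then interpret triangle P l k .
  have scale: "scale_size P f = size_of f" if "irreducible f" for f
    using that by (intro scale_size_eq) (auto simp: irreducible_def)
  show ?thesis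
  proof (intro conjI allI impI)
    fix f :: lattice_fun and e1 e2 w v :: real
    assume f: "irreducible f" and e: "(e1, e2) = inverse (scale_size P f) *\<^sub>R nat_vec (sm f)"
      and w: "w = e1 + e2" "sqrt (2 * vol P) \<le> w" and v: "v = 2 * vol P / w"
    show "S_set P = convex hull {(0, 0), (v, 0), (e1, e2), (0, v)}"
      using S_set_of_irreducible[OF f e[unfolded scale[OF f]] w[unfolded vol_def] v[unfolded vol_def]]
      by (simp add: kite_def)
  next
    fix v :: real
    assume none: "\<not> (\<exists>f :: int \<times> int \<Rightarrow>\<^sub>0 real. irreducible f \<and>
        inverse (scale_size P f) * real (fst (sm f) + snd (sm f)) \<ge> sqrt (2 * vol P))"
      and v: "v = sqrt (2 * vol P)"
    have "inverse (size_of f) * real (mult_at_one f) < sqrt (2 * measure lebesgue P)" if "irreducible f" for f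
    proof -
      have "\<not> sqrt (2 * vol P) \<le> inverse (scale_size P f) * real (fst (sm f) + snd (sm f))"
        using none that by blast
      then show ?thesis by (simp add: scale[OF that] vol_def)
    qed
    from S_set_without_irreducible[OF this v[unfolded vol_def]]
    show "S_set P = convex hull {(0, 0), (v, 0), (0, v)}" by (simp add: kite_def)
  qed
qed

end
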